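(* Let $f\colon\mathbb{R}^n\to\mathbb{R}$ be continuously differentiable, let $F\colon\mathbb{R}^n\to\mathbb{R}^\ell$ be directionally differentiable and locally Lipschitz continuous, and let $\Gamma\subseteq\mathbb{R}^\ell$ be nonempty and closed. Let $\bar x\in\mathbb{R}^n$ be a local minimizer of $\min_x f(x)$ s.t. $F(x)\in\Gamma$ such that $F$ is continuously differentiable around $\bar x$, let GGCQ hold at $\bar x$, and fix a direction $d\in C(\bar x)\cap\mathbb{S}$. Finally, let one of the following conditions hold. (a) The set $\Gamma$ is polyhedral locally around $F(\bar x)$. (b) The set $\Gamma$ is convex locally around $F(\bar x)$, and the set-valued mapping $u\mapsto\{F'(\bar x)u\}-T_\Gamma(F(\bar x))$ is metrically subregular in direction $d$ at $(0,0)$. Then $\bar x$ is M-stationary in direction $d$.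
   Context: Notation. $\|\cdot\|$ is the Euclidean norm, $\mathbb{S}$ the unit sphere, $\mathbb{B}_\varepsilon(x)$ the closed ball; $A^\circ=\{y : x^\top y\le0\ \forall x\in A\}$ is the polar cone. For a closed set $\Omega\subseteq\mathbb{R}^m$, $z\in\Omega$, $w\in\mathbb{R}^m$: $T_\Omega(z)=\{v : \exists v^k\to v,\ t_k\downarrow 0,\ z+t_kv^k\in\Omega\ \forall k\}$; $\widehat N_\Omega(z)=T_\Omega(z)^\circ$; $N_\Omega(z;w)=\{\eta : \exists w^k\to w,\ t_k\downarrow0,\ \eta^k\to\eta,\ \eta^k\in\widehat N_\Omega(z+t_kw^k)\ \forall k\}$ (with $\widehat N_\Omega(z')=\emptyset$ for $z'\notin\Omega$). For a directionally differentiable, locally Lipschitz $\varphi\colon\mathbb{R}^n\to\mathbb{R}$: $\partial\varphi(x;d)=\{\xi : (\xi,-1)\in N_{\operatorname{epi}\varphi}((x,\varphi(x));(d,\varphi'(x;d)))\}$, with $\varphi'(x;d)$ the directional derivative and $\operatorname{epi}\varphi=\{(x,\alpha):\varphi(x)\le\alpha\}$. $\langle\lambda,F\rangle(x)=\lambda^\top F(x)$; if $F$ is continuously differentiable at $\bar x$, then $\partial\langle\lambda,F\rangle(\bar x;d)=\{F'(\bar x)^\top\lambda\}$. A set is polyhedral if it is a union of finitely many convex polyhedral sets. That $\Gamma$ is polyhedral (convex) locally around a point $y$ means that it has this property in a neighborhood of $y$. Feasible set: $X=F^{-1}(\Gamma)$. Linearization cone: $T^{\rm lin}_{F,\Gamma}(\bar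 x)=\{d : F'(\bar x;d)\in T_\Gamma(F(\bar x))\}$. Explicit critical cone: $C(\bar x)=\{d : f'(\bar x)d\le0,\ d\in T^{\rm lin}_{F,\Gamma}(\bar x)\}$. GGCQ (generalized Guignard constraint qualification) at $\bar x$: $\widehat N_X(\bar x)=T^{\rm lin}_{F,\Gamma}(\bar x)^\circ$. A set-valued mapping $\Upsilon\colon\mathbb{R}^n\rightrightarrows\mathbb{R}^\ell$ is metrically subregular in direction $d$ at $(\bar u,\bar y)$, $\bar y\in\Upsilon(\bar u)$, if there are $\varepsilon,\delta,\kappa>0$ with $\operatorname{dist}(u,\Upsilon^{-1}(\bar y))\le\kappa\operatorname{dist}(\bar y,\Upsilon(u))$ for all $u\in\{\bar u\}+\mathbb{B}_{\varepsilon,\delta}(d)$, where $\mathbb{B}_{\varepsilon,\delta}(d)=\{y\in\mathbb{B}_\varepsilon(0) : \big\|\,\|d\|y-\|y\|d\,\big\|\le\delta\|y\|\|d\|\}$. A feasible point $\bar x$ is M-stationary in direction $d\in C(\bar x)$ if there is $\lambda\in\mathbb{R}^\ell$ with $-\nabla f(\bar x)\in\partial\langle\lambda,F\rangle(\bar x;d)$ and $\lambda\in N_\Gamma(F(\bar x);F'(\bar x;d))$. *)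

theory Defs
  imports "HOL-Analysis.Analysis"
begin

section \<open>Cones\<close>

definition polar_cone :: "'a::real_inner set \<Rightarrow> 'a set" where
  "polar_cone A = {y. \<forall>x\<in>A. y \<bullet> x \<le> 0}"

(* Here and below, t_k decreasing to 0 means: t_k > 0 and t_k tends to 0. *)
definition tangent_cone :: "'a::real_inner set \<Rightarrow> 'a \<Rightarrow> 'a set" where
  "tangent_cone \<Omega> z = {v. \<exists>(v' :: nat \<Rightarrow> 'a) (t :: nat \<Rightarrow> real).
      v' \<longlonglongrightarrow> v \<and> (\<forall>k. t k > 0) \<and> t \<longlonglongrightarrow> 0 \<and> (\<forall>k. z + t k *\<^sub>R v' k \<in> \<Omega>)}"

definition regular_normal_cone :: "'a::real_inner set \<Rightarrow> 'a \<Rightarrow> 'a set" where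
  "regular_normal_cone \<Omega> z = (if z \<in> \<Omega> then polar_cone (tangent_cone \<Omega> z) else {})"

definition directional_normal_cone :: "'a::real_inner set \<Rightarrow> 'a \<Rightarrow> 'a \<Rightarrow> 'a set" where
  "directional_normal_cone \<Omega> z w = {\<eta>. \<exists>(w' :: nat \<Rightarrow> 'a) (t :: nat \<Rightarrow> real) (\<eta>' :: nat \<Rightarrow> 'a).
      w' \<longlonglongrightarrow> w \<and> (\<forall>k. t k > 0) \<and> t \<longlonglongrightarrow> 0 \<and> \<eta>' \<longlonglongrightarrow> \<eta> \<and>
      (\<forall>k. \<eta>' k \<in> regular_normal_cone \<Omega> (z + t k *\<^sub>R w' k))}"


section \<open>Differentiability and subdifferential\<close>

definition directionally_differentiable ::
    "('a::real_normed_vector \<Rightarrow> 'b::real_normed_vector) \<Rightarrow> bool" where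
  "directionally_differentiable \<phi> \<longleftrightarrow>
     (\<forall>x d. \<exists>l. ((\<lambda>t. (\<phi> (x + t *\<^sub>R d) - \<phi> x) /\<^sub>R t) \<longlongrightarrow> l) (at_right 0))"

definition dir_deriv ::
    "('a::real_normed_vector \<Rightarrow> 'b::real_normed_vector) \<Rightarrow> 'a \<Rightarrow> 'a \<Rightarrow> 'b" where
  "dir_deriv \<phi> x d = Lim (at_right 0) (\<lambda>t. (\<phi> (x + t *\<^sub>R d) - \<phi> x) /\<^sub>R t)"

definition locally_lipschitz :: "('a::metric_space \<Rightarrow> 'b::metric_space) \<Rightarrow> bool" where
  "locally_lipschitz \<phi> \<longleftrightarrow> (\<forall>x. \<exists>r>0. \<exists>L. L-lipschitz_on (cball x r) \<phi>)"

(* Meant for open S. *)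
definition continuously_differentiable_on ::
    "('a::real_normed_vector \<Rightarrow> 'b::real_normed_vector) \<Rightarrow> 'a set \<Rightarrow> bool" where
  "continuously_differentiable_on \<phi> S \<longleftrightarrow>
     (\<exists>\<phi>' :: 'a \<Rightarrow> 'a \<Rightarrow>\<^sub>L 'b.
        (\<forall>x\<in>S. (\<phi> has_derivative blinfun_apply (\<phi>' x)) (at x)) \<and> continuous_on S \<phi>')"

definition continuously_differentiable_around ::
    "('a::real_normed_vector \<Rightarrow> 'b::real_normed_vector) \<Rightarrow> 'a \<Rightarrow> bool" where
  "continuously_differentiable_around \<phi> x \<longleftrightarrow>
     (\<exists>U. open U \<and> x \<in> U \<and> continuously_differentiable_on \<phi> U)"

definition gradient :: "('a::real_inner \<Rightarrow> real) \<Rightarrow> 'a \<Rightarrow> 'a" where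
  "gradient \<phi> x = (THE g. GDERIV \<phi> x :> g)"

definition directional_subdifferential :: "('a::real_inner \<Rightarrow> real) \<Rightarrow> 'a \<Rightarrow> 'a \<Rightarrow> 'a set" where
  "directional_subdifferential \<phi> x d =
     {\<xi>. (\<xi>, -1) \<in> directional_normal_cone (epigraph UNIV \<phi>) (x, \<phi> x) (d, dir_deriv \<phi> x d)}"


section \<open>Local geometry of sets\<close>

definition polyhedral :: "'a::euclidean_space set \<Rightarrow> bool" where
  "polyhedral S \<longleftrightarrow> (\<exists>\<P>. finite \<P> \<and> (\<forall>P\<in>\<P>. polyhedron P) \<and> S = \<Union>\<P>)"

(* S has property P in a neighborhood of y: near y, S coincides with a set having P.
   Intersecting S itself with an arbitrary neighborhood, such as a ball, would not do for
   polyhedrality, since the intersection need not be polyhedral. *)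
definition locally_around ::
    "('a::topological_space set \<Rightarrow> bool) \<Rightarrow> 'a set \<Rightarrow> 'a \<Rightarrow> bool" where
  "locally_around P S y \<longleftrightarrow> (\<exists>U T. open U \<and> y \<in> U \<and> P T \<and> S \<inter> U = T \<inter> U)"


section \<open>Directional metric subregularity\<close>

definition directional_ball :: "real \<Rightarrow> real \<Rightarrow> 'a::real_normed_vector \<Rightarrow> 'a set" where
  "directional_ball \<epsilon> \<delta> d =
     {y \<in> cball 0 \<epsilon>. norm (norm d *\<^sub>R y - norm y *\<^sub>R d) \<le> \<delta> * norm y * norm d}"

(* The distance to the empty set is infinite, whereas infdist returns 0 in that case. Hence
   points u with \<Upsilon> u = {} impose no condition; the preimage of y0 contains u0. *)
definition metrically_subregular_in_direction ::
    "('a::real_normed_vector \<Rightarrow> 'b::real_normed_vector set) \<Rightarrow> 'a \<Rightarrow> 'a \<Rightarrow> 'b \<Rightarrow> bool" where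
  "metrically_subregular_in_direction \<Upsilon> d u0 y0 \<longleftrightarrow>
     y0 \<in> \<Upsilon> u0 \<and>
     (\<exists>\<epsilon>>0. \<exists>\<delta>>0. \<exists>\<kappa>>0. \<forall>u. u - u0 \<in> directional_ball \<epsilon> \<delta> d \<longrightarrow> \<Upsilon> u \<noteq> {} \<longrightarrow>
        infdist u {u'. y0 \<in> \<Upsilon> u'} \<le> \<kappa> * infdist y0 (\<Upsilon> u))"


section \<open>The problem of minimizing f(x) subject to F(x) in Gamma\<close>

definition feasible_set :: "('a \<Rightarrow> 'b) \<Rightarrow> 'b set \<Rightarrow> 'a set" where
  "feasible_set F \<Gamma> = F -` \<Gamma>"

definition local_minimizer ::
    "('a::metric_space \<Rightarrow> real) \<Rightarrow> ('a \<Rightarrow> 'b) \<Rightarrow> 'b set \<Rightarrow> 'a \<Rightarrow> bool" where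
  "local_minimizer f F \<Gamma> x \<longleftrightarrow>
     x \<in> feasible_set F \<Gamma> \<and> (\<exists>r>0. \<forall>y \<in> feasible_set F \<Gamma> \<inter> ball x r. f x \<le> f y)"

definition linearization_cone ::
    "('a::real_inner \<Rightarrow> 'b::real_inner) \<Rightarrow> 'b set \<Rightarrow> 'a \<Rightarrow> 'a set" where
  "linearization_cone F \<Gamma> x = {d. dir_deriv F x d \<in> tangent_cone \<Gamma> (F x)}"

definition critical_cone ::
    "('a::real_inner \<Rightarrow> real) \<Rightarrow> ('a \<Rightarrow> 'b::real_inner) \<Rightarrow> 'b set \<Rightarrow> 'a \<Rightarrow> 'a set" where
  "critical_cone f F \<Gamma> x =
     {d. frechet_derivative f (at x) d \<le> 0 \<and> d \<in> linearization_cone F \<Gamma> x}"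

definition GGCQ :: "('a::real_inner \<Rightarrow> 'b::real_inner) \<Rightarrow> 'b set \<Rightarrow> 'a \<Rightarrow> bool" where
  "GGCQ F \<Gamma> x \<longleftrightarrow>
     regular_normal_cone (feasible_set F \<Gamma>) x = polar_cone (linearization_cone F \<Gamma> x)"

definition M_stationary_in_direction ::
    "('a::real_inner \<Rightarrow> real) \<Rightarrow> ('a \<Rightarrow> 'b::real_inner) \<Rightarrow> 'b set \<Rightarrow> 'a \<Rightarrow> 'a \<Rightarrow> bool" where
  "M_stationary_in_direction f F \<Gamma> x d \<longleftrightarrow>
     x \<in> feasible_set F \<Gamma> \<and> d \<in> critical_cone f F \<Gamma> x \<and>
     (\<exists>\<mu>. - gradient f x \<in> directional_subdifferential (\<lambda>y. \<mu> \<bullet> F y) x d \<and>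
          \<mu> \<in> directional_normal_cone \<Gamma> (F x) (dir_deriv F x d))"

(* The mapping taking u to {F'(x)u} - T with T the tangent cone to \<Gamma> at F(x). It is an
   algebraic (Minkowski) difference; minus on sets in HOL is the set-theoretic one. *)
definition linearized_feasibility_map ::
    "('a::real_inner \<Rightarrow> 'b::real_inner) \<Rightarrow> 'b set \<Rightarrow> 'a \<Rightarrow> 'a \<Rightarrow> 'b set" where
  "linearized_feasibility_map F \<Gamma> x u =
     {frechet_derivative F (at x) u - v | v. v \<in> tangent_cone \<Gamma> (F x)}"

end

theory Submission
  imports Defs
begin

text \<open>Put \<open>A = F'(x)\<close>, \<open>T\<close> the tangent cone to \<open>\<Gamma>\<close> at \<open>F x\<close>, \<open>L = {u. A u \<in> T}\<close> and
  \<open>g = - \<nabla>f(x)\<close>. By GGCQ, \<open>g\<close> is polar to \<open>L\<close> and orthogonal to \<open>d\<close>. Both (a), through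
  Hoffman's bound for each polyhedral piece of \<open>T\<close>, and (b) yield an error bound
  \<open>dist u L \<le> \<kappa> |A u - v|\<close> for \<open>u\<close> near \<open>d\<close> and \<open>v \<in> T\<close>, so that
  \<open>g \<bullet> (u - d) \<le> C |A u - v|\<close>. Minimizing
  \<open>k |A u - v|\<^sup>2 / 2 - g \<bullet> (u - d) + |u - d|\<^sup>2 / 2 + |v - A d|\<^sup>2 / 2\<close> over \<open>v \<in> T\<close> produces
  multipliers \<open>k (A u - v)\<close> that stay bounded by \<open>2 C\<close> as \<open>k\<close> grows and are, up to vanishing
  terms, proximal normals to \<open>T\<close> at points converging to \<open>A d\<close>. Proximal normals to \<open>T\<close> are
  directional normals to \<open>\<Gamma>\<close>, and a cluster point of the multipliers is the one sought.\<close>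

section \<open>Differentiability\<close>

text \<open>After division by \<open>t k\<close> the remainder is
  \<open>R (t k *\<^sub>R v k) * norm (v k)\<close>, a null sequence times a bounded one. The
  directions may vary with \<open>k\<close> because tangent vectors are only limits of the
  directions that reach the set.\<close>

lemma has_derivative_sequential_quotient:
  fixes \<phi> :: "'a::real_normed_vector \<Rightarrow> 'b::real_normed_vector"
  assumes D: "(\<phi> has_derivative D) (at x)"
    and v: "v \<longlonglongrightarrow> l" and t: "\<And>k. t k > 0" "t \<longlonglongrightarrow> 0"
  shows "(\<lambda>k. (\<phi> (x + t k *\<^sub>R v k) - \<phi> x) /\<^sub>R t k) \<longlonglongrightarrow> D l"
proof -
  have bl: "bounded_linear D" using D has_derivative_bounded_linear by blast
  then interpret D: bounded_linear D .
  \<comment> \<open>The value 0 at 0 makes \<open>R\<close> continuous there and covers the indices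
    with \<open>v k = 0\<close>.\<close>
  define R where "R h = (if h = 0 then 0 else norm (\<phi> (x + h) - \<phi> x - D h) / norm h)" for h
  have "R \<midarrow>0\<rightarrow> 0"
    using D unfolding has_derivative_at R_def
    by (auto elim!: Lim_transform_eventually simp: eventually_at_filter)
  then have "isCont R 0" by (simp add: isCont_def R_def)
  moreover have "(\<lambda>k. t k *\<^sub>R v k) \<longlonglongrightarrow> 0"
    using tendsto_scaleR[OF t(2) v] by simp
  ultimately have "(\<lambda>k. R (t k *\<^sub>R v k)) \<longlonglongrightarrow> R 0"
    by (rule isCont_tendsto_compose)
  then have "(\<lambda>k. R (t k *\<^sub>R v k) * norm (v k)) \<longlonglongrightarrow> 0 * norm l"
    by (intro tendsto_mult tendsto_norm v) (simp add: R_def)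
  moreover have "norm ((\<phi> (x + t k *\<^sub>R v k) - \<phi> x) /\<^sub>R t k - D (v k)) = R (t k *\<^sub>R v k) * norm (v k)" for k
  proof -
    have "(\<phi> (x + t k *\<^sub>R v k) - \<phi> x) /\<^sub>R t k - D (v k)
        = (\<phi> (x + t k *\<^sub>R v k) - \<phi> x - D (t k *\<^sub>R v k)) /\<^sub>R t k"
      using t(1)[of k] by (simp add: D.scaleR algebra_simps)
    then show ?thesis
      using t(1)[of k] by (auto simp: R_def divide_simps)
  qed
  ultimately have "(\<lambda>k. (\<phi> (x + t k *\<^sub>R v k) - \<phi> x) /\<^sub>R t k - D (v k)) \<longlonglongrightarrow> 0"
    by (subst tendsto_norm_zero_iff[symmetric]) simp
  from tendsto_add[OF this D.tendsto[OF v]] show ?thesis by simp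
qed

lemma dir_deriv_eq_derivative:
  assumes D: "(\<phi> has_derivative D) (at x)"
  shows "dir_deriv \<phi> x d = D d"
proof -
  have "((\<lambda>t. (\<phi> (x + t *\<^sub>R d) - \<phi> x) /\<^sub>R t) \<longlongrightarrow> D d) (at_right 0)"
  proof (rule tendsto_at_right_sequentially[of 0 1])
    fix S :: "nat \<Rightarrow> real"
    assume "\<And>n. 0 < S n" "S \<longlonglongrightarrow> 0"
    then show "(\<lambda>n. (\<phi> (x + S n *\<^sub>R d) - \<phi> x) /\<^sub>R S n) \<longlonglongrightarrow> D d"
      using has_derivative_sequential_quotient[OF D, of "\<lambda>_. d"] by simp
  qed simp
  then show ?thesis
    unfolding dir_deriv_def by (intro tendsto_Lim) auto
qed

lemma linear_functional_inner:
  fixes D :: "'a::euclidean_space \<Rightarrow> real"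
  assumes "linear D"
  shows "D h = h \<bullet> (\<Sum>b\<in>Basis. D b *\<^sub>R b)"
proof -
  have "D h = D (\<Sum>b\<in>Basis. (h \<bullet> b) *\<^sub>R b)" by (simp add: euclidean_representation)
  also have "\<dots> = (\<Sum>b\<in>Basis. (h \<bullet> b) * D b)"
    using assms by (simp add: linear_sum linear_cmul)
  finally show ?thesis by (simp add: inner_sum_right mult.commute)
qed

lemma has_derivative_imp_GDERIV:
  fixes \<phi> :: "'a::euclidean_space \<Rightarrow> real"
  assumes D: "(\<phi> has_derivative D) (at x)"
  shows "GDERIV \<phi> x :> (\<Sum>b\<in>Basis. D b *\<^sub>R b)"
proof -
  have "linear D" using D has_derivative_linear by blast
  then have "D = (\<lambda>h. h \<bullet> (\<Sum>b\<in>Basis. D b *\<^sub>R b))" using linear_functional_inner by blast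
  with D show ?thesis unfolding gderiv_def by metis
qed

lemma GDERIV_unique:
  assumes "GDERIV \<phi> x :> g" "GDERIV \<phi> x :> g'"
  shows "g = g'"
proof -
  have "(\<lambda>h. h \<bullet> g) = (\<lambda>h. h \<bullet> g')"
    using assms has_derivative_unique unfolding gderiv_def by blast
  then show ?thesis by (metis vector_eq_ldot)
qed

lemma gradient_eq: "GDERIV \<phi> x :> g \<Longrightarrow> gradient \<phi> x = g"
  unfolding gradient_def by (blast intro: GDERIV_unique)

section \<open>Tangent and normal cones\<close>

text \<open>Along \<open>z + t k *\<^sub>R v' k\<close> the quadratic bound, divided by
  \<open>t k\<close>, has a right-hand side of order \<open>t k\<close>. The constant
  \<open>M\<close> therefore disappears in the limit, however large it is.\<close>

lemma proximal_normal_imp_regular_normal: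
  assumes z: "z \<in> \<Omega>" and \<eta>: "\<And>p. p \<in> \<Omega> \<Longrightarrow> \<eta> \<bullet> (p - z) \<le> M * (norm (p - z))\<^sup>2"
  shows "\<eta> \<in> regular_normal_cone \<Omega> z"
proof -
  have "\<eta> \<bullet> v \<le> 0" if v: "v \<in> tangent_cone \<Omega> z" for v
  proof -
    from v obtain v' t where v': "v' \<longlonglongrightarrow> v" and t: "\<And>k. t k > 0" "t \<longlonglongrightarrow> 0"
      and mem: "\<And>k. z + t k *\<^sub>R v' k \<in> \<Omega>"
      unfolding tangent_cone_def by auto
    have "\<eta> \<bullet> v' k \<le> M * t k * (norm (v' k))\<^sup>2" for k
    proof -
      have "t k * (\<eta> \<bullet> v' k) \<le> t k * (M * t k * (norm (v' k))\<^sup>2)"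
        using \<eta>[OF mem[of k]] t(1)[of k] by (simp add: power2_eq_square algebra_simps)
      then show ?thesis using t(1)[of k] by simp
    qed
    moreover have "(\<lambda>k. M * t k * (norm (v' k))\<^sup>2) \<longlonglongrightarrow> M * 0 * (norm v)\<^sup>2"
      by (intro tendsto_intros t v')
    moreover have "(\<lambda>k. \<eta> \<bullet> v' k) \<longlonglongrightarrow> \<eta> \<bullet> v"
      by (intro tendsto_intros v')
    ultimately show ?thesis
      using LIMSEQ_le[of "\<lambda>k. \<eta> \<bullet> v' k"] by fastforce
  qed
  with z show ?thesis
    by (simp add: regular_normal_cone_def polar_cone_def)
qed

text \<open>This form with a single witness per tolerance spares the diagonal sequences in the
  proofs of closedness and of the finite union rule.\<close>

lemma tangent_cone_iff:
  "v \<in> tangent_cone \<Omega> z \<longleftrightarrow>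
     (\<forall>\<delta>>0. \<exists>t v'. 0 < t \<and> t < \<delta> \<and> dist v' v < \<delta> \<and> z + t *\<^sub>R v' \<in> \<Omega>)" (is "_ \<longleftrightarrow> ?R")
proof
  assume "v \<in> tangent_cone \<Omega> z"
  then obtain v' t where v': "v' \<longlonglongrightarrow> v" and t: "\<And>k. t k > 0" "t \<longlonglongrightarrow> 0"
    and mem: "\<And>k. z + t k *\<^sub>R v' k \<in> \<Omega>"
    unfolding tangent_cone_def by auto
  show ?R
  proof (intro allI impI)
    fix \<delta> :: real assume \<delta>: "\<delta> > 0"
    have "\<forall>\<^sub>F k in sequentially. t k < \<delta> \<and> dist (v' k) v < \<delta>"
      using order_tendstoD(2)[OF t(2) \<delta>] tendstoD[OF v' \<delta>] by eventually_elim auto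
    then obtain k where "t k < \<delta>" "dist (v' k) v < \<delta>"
      by (auto dest: eventually_happens)
    with t(1) mem show "\<exists>t v'. 0 < t \<and> t < \<delta> \<and> dist v' v < \<delta> \<and> z + t *\<^sub>R v' \<in> \<Omega>"
      by blast
  qed
next
  assume R: ?R
  have "\<exists>t v'. 0 < t \<and> t < inverse (real (Suc k)) \<and> dist v' v < inverse (real (Suc k))
          \<and> z + t *\<^sub>R v' \<in> \<Omega>" for k
    using R by simp
  then obtain t v' where tv: "\<And>k. 0 < t k" "\<And>k. t k < inverse (real (Suc k))"
      "\<And>k. dist (v' k) v < inverse (real (Suc k))" "\<And>k. z + t k *\<^sub>R v' k \<in> \<Omega>"
    by metis
  have "t \<longlonglongrightarrow> 0"
    by (rule LIMSEQ_norm_0) (use tv(1,2) in \<open>simp add: abs_of_pos inverse_eq_divide del: of_nat_Suc\<close>)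
  moreover have "(\<lambda>k. dist (v' k) v) \<longlonglongrightarrow> 0"
    by (rule LIMSEQ_norm_0) (use tv(3) in \<open>simp add: inverse_eq_divide del: of_nat_Suc\<close>)
  then have "v' \<longlonglongrightarrow> v" by (rule iffD2[OF tendsto_dist_iff])
  ultimately show "v \<in> tangent_cone \<Omega> z"
    unfolding tangent_cone_def using tv by blast
qed

lemma closed_tangent_cone: "closed (tangent_cone \<Omega> z)"
  unfolding closure_subset_eq[symmetric]
proof
  fix v assume v: "v \<in> closure (tangent_cone \<Omega> z)"
  show "v \<in> tangent_cone \<Omega> z"
    unfolding tangent_cone_iff
  proof (intro allI impI)
    fix \<delta> :: real assume "\<delta> > 0"
    then obtain w where w: "w \<in> tangent_cone \<Omega> z" "dist w v < \<delta> / 2"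
      using v unfolding closure_approachable by (meson half_gt_zero)
    from w(1) \<open>\<delta> > 0\<close> obtain t v' where tv: "0 < t" "t < \<delta> / 2" "dist v' w < \<delta> / 2" "z + t *\<^sub>R v' \<in> \<Omega>"
      unfolding tangent_cone_iff by (meson half_gt_zero)
    have "dist v' v < \<delta>"
      using tv(3) w(2) dist_triangle[of v' v w] by simp
    then show "\<exists>t v'. 0 < t \<and> t < \<delta> \<and> dist v' v < \<delta> \<and> z + t *\<^sub>R v' \<in> \<Omega>"
      using tv \<open>\<delta> > 0\<close> by (intro exI[of _ t] exI[of _ v']) auto
  qed
qed

lemma tangent_cone_scaleR:
  assumes v: "v \<in> tangent_cone \<Omega> z" and s: "s > 0"
  shows "s *\<^sub>R v \<in> tangent_cone \<Omega> z"
proof -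
  from v obtain v' t where v': "v' \<longlonglongrightarrow> v" and t: "\<And>k. t k > 0" "t \<longlonglongrightarrow> 0"
    and mem: "\<And>k. z + t k *\<^sub>R v' k \<in> \<Omega>"
    unfolding tangent_cone_def by auto
  have "(\<lambda>k. s *\<^sub>R v' k) \<longlonglongrightarrow> s *\<^sub>R v" by (intro tendsto_intros v')
  moreover have "(\<lambda>k. t k / s) \<longlonglongrightarrow> 0" using tendsto_divide[OF t(2) tendsto_const[of s]] s by simp
  moreover have "\<forall>k. z + (t k / s) *\<^sub>R s *\<^sub>R v' k \<in> \<Omega>" using s mem by simp
  ultimately show ?thesis
    unfolding tangent_cone_def using t(1) s
    by (intro CollectI exI[of _ "\<lambda>k. s *\<^sub>R v' k"] exI[of _ "\<lambda>k. t k / s"]) auto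
qed

section \<open>Limits of directional normals, and proximal normals to the tangent cone\<close>

text \<open>Diagonal choice: from the sequences that witness \<open>\<eta> n\<close> a single triple
  within \<open>1 / (n + 1)\<close> of its limits is taken.\<close>

lemma directional_normal_cone_limit:
  assumes \<eta>: "\<And>n. \<eta> n \<in> directional_normal_cone \<Omega> z (w n)"
    and lim: "w \<longlonglongrightarrow> w\<^sub>0" "\<eta> \<longlonglongrightarrow> \<eta>\<^sub>0"
  shows "\<eta>\<^sub>0 \<in> directional_normal_cone \<Omega> z w\<^sub>0"
proof -
  have "\<exists>t w' \<eta>'. 0 < t \<and> t < inverse (real (Suc n)) \<and> dist w' (w n) < inverse (real (Suc n))
          \<and> dist \<eta>' (\<eta> n) < inverse (real (Suc n)) \<and> \<eta>' \<in> regular_normal_cone \<Omega> (z + t *\<^sub>R w')" for n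
  proof -
    obtain w' t \<eta>' where w': "w' \<longlonglongrightarrow> w n" and t: "\<And>k. t k > 0" "t \<longlonglongrightarrow> 0"
      and \<eta>': "\<eta>' \<longlonglongrightarrow> \<eta> n" and mem: "\<And>k. \<eta>' k \<in> regular_normal_cone \<Omega> (z + t k *\<^sub>R w' k)"
      using \<eta>[of n] unfolding directional_normal_cone_def by auto
    have pos: "inverse (real (Suc n)) > 0" by simp
    have "\<forall>\<^sub>F k in sequentially. t k < inverse (real (Suc n)) \<and> dist (w' k) (w n) < inverse (real (Suc n))
             \<and> dist (\<eta>' k) (\<eta> n) < inverse (real (Suc n))"
      using order_tendstoD(2)[OF t(2) pos] tendstoD[OF w' pos] tendstoD[OF \<eta>' pos]
      by eventually_elim auto
    then obtain k where "t k < inverse (real (Suc n))" "dist (w' k) (w n) < inverse (real (Suc n))"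
       "dist (\<eta>' k) (\<eta> n) < inverse (real (Suc n))"
      by (auto dest: eventually_happens)
    with t(1) mem show ?thesis by blast
  qed
  then obtain t w' \<eta>' where *: "\<And>n. 0 < t n" "\<And>n. t n < inverse (real (Suc n))"
      "\<And>n. dist (w' n) (w n) < inverse (real (Suc n))"
      "\<And>n. dist (\<eta>' n) (\<eta> n) < inverse (real (Suc n))"
      "\<And>n. \<eta>' n \<in> regular_normal_cone \<Omega> (z + t n *\<^sub>R w' n)"
    by metis
  note squeeze = tendsto_sandwich[OF _ _ tendsto_const LIMSEQ_inverse_real_of_nat]
  have "t \<longlonglongrightarrow> 0"
    by (rule squeeze) (auto intro!: always_eventually less_imp_le * simp del: of_nat_Suc)
  moreover have "(\<lambda>n. dist (w' n) (w n)) \<longlonglongrightarrow> 0" "(\<lambda>n. dist (\<eta>' n) (\<eta> n)) \<longlonglongrightarrow> 0"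
    by (rule squeeze; auto intro!: always_eventually less_imp_le * simp del: of_nat_Suc)+
  then have "(\<lambda>n. w' n - w n) \<longlonglongrightarrow> 0" "(\<lambda>n. \<eta>' n - \<eta> n) \<longlonglongrightarrow> 0"
    by (simp_all add: dist_norm tendsto_norm_zero_iff)
  from tendsto_add[OF this(1) lim(1)] tendsto_add[OF this(2) lim(2)]
  have "w' \<longlonglongrightarrow> w\<^sub>0" "\<eta>' \<longlonglongrightarrow> \<eta>\<^sub>0" by simp_all
  ultimately show ?thesis
    unfolding directional_normal_cone_def using * by blast
qed

text \<open>Project \<open>y + t k *\<^sub>R c\<close> with
  \<open>c = v + \<epsilon> *\<^sub>R \<eta>\<close> onto \<open>\<Gamma>\<close> and rescale the
  projections to \<open>p k\<close>. Every cluster point \<open>l\<close> of \<open>p\<close> is a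
  tangent vector no farther from \<open>c\<close> than \<open>v\<close>, and the proximal inequality
  at \<open>v\<close> leaves only \<open>l = v\<close>. The projection residuals
  \<open>(c - p k) /\<^sub>R \<epsilon>\<close> are regular normals to \<open>\<Gamma>\<close> and
  tend to \<open>\<eta>\<close> along a subsequence.\<close>

lemma proximal_normal_tangent_cone_imp_directional_normal:
  fixes \<Gamma> :: "'a::euclidean_space set"
  assumes cl: "closed \<Gamma>" and v: "v \<in> tangent_cone \<Gamma> y" and \<delta>: "\<delta> > 0"
    and prox: "\<And>p. p \<in> tangent_cone \<Gamma> y \<Longrightarrow> dist p v < \<delta> \<Longrightarrow> \<eta> \<bullet> (p - v) \<le> M * (norm (p - v))\<^sup>2"
  shows "\<eta> \<in> directional_normal_cone \<Gamma> y v"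
proof -
  from v obtain v' t where v': "v' \<longlonglongrightarrow> v" and t: "\<And>k. t k > 0" "t \<longlonglongrightarrow> 0"
    and mem: "\<And>k. y + t k *\<^sub>R v' k \<in> \<Gamma>"
    unfolding tangent_cone_def by auto
  \<comment> \<open>The first term yields \<open>2 * \<epsilon> * \<bar>M\<bar> < 1\<close>, which
    forces \<open>l = v\<close> below. The second keeps \<open>l\<close> within
    \<open>\<delta>\<close> of \<open>v\<close>, where \<open>prox\<close> applies.\<close>
  define \<epsilon> where "\<epsilon> = min (1 / (4 * (\<bar>M\<bar> + 1))) (\<delta> / (4 * (norm \<eta> + 1)))"
  have \<epsilon>: "\<epsilon> > 0" using \<delta> by (simp add: \<epsilon>_def add_nonneg_pos)
  have "\<epsilon> \<le> 1 / (4 * (\<bar>M\<bar> + 1))" by (simp add: \<epsilon>_def)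
  then have \<epsilon>M: "2 * \<epsilon> * \<bar>M\<bar> < 1" using \<epsilon> by (simp add: field_simps)
  have "\<epsilon> \<le> \<delta> / (4 * (norm \<eta> + 1))" by (simp add: \<epsilon>_def)
  then have "\<epsilon> * (4 * (norm \<eta> + 1)) \<le> \<delta>"
    by (subst (asm) pos_le_divide_eq) (auto simp: add_nonneg_pos)
  moreover have "0 \<le> \<epsilon> * norm \<eta>" using \<epsilon> by simp
  ultimately have \<epsilon>\<eta>: "2 * \<epsilon> * norm \<eta> < \<delta>" using \<epsilon> unfolding distrib_left by linarith
  define c where "c = v + \<epsilon> *\<^sub>R \<eta>"
  have "\<exists>q\<in>\<Gamma>. \<forall>q'\<in>\<Gamma>. dist (y + t k *\<^sub>R c) q \<le> dist (y + t k *\<^sub>R c) q'" for k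
    using distance_attains_inf[OF cl] mem by (metis empty_iff)
  then obtain q where q: "\<And>k. q k \<in> \<Gamma>"
     and qmin: "\<And>k q'. q' \<in> \<Gamma> \<Longrightarrow> dist (y + t k *\<^sub>R c) (q k) \<le> dist (y + t k *\<^sub>R c) q'"
    by metis
  define p where "p k = (q k - y) /\<^sub>R t k" for k
  have qp: "q k = y + t k *\<^sub>R p k" for k
    using t(1)[of k] by (simp add: p_def)
  have pc: "norm (c - p k) \<le> norm (c - v' k)" for k
  proof -
    have "t k * norm (c - p k) \<le> t k * norm (c - v' k)"
      using qmin[OF mem[of k], of k] t(1)[of k]
      by (simp add: qp dist_norm flip: scaleR_diff_right)
    then show ?thesis using t(1)[of k] by simp
  qed
  have "(\<lambda>k. norm (c - v' k)) \<longlonglongrightarrow> norm (c - v)"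
    by (intro tendsto_intros v')
  then have "Bseq (\<lambda>k. norm (c - v' k))" by (intro convergent_imp_Bseq convergentI)
  then obtain B where B: "\<And>k. norm (c - v' k) \<le> B" unfolding Bseq_def by auto
  have "norm (p k) \<le> B + norm c" for k
    using pc[of k] B[of k] norm_triangle_ineq4[of c "c - p k"] by simp
  then have "bounded (range p)" by (auto simp: bounded_iff)
  then obtain l r where r: "strict_mono r" and pl: "(p \<circ> r) \<longlonglongrightarrow> l"
    using bounded_imp_convergent_subsequence by blast
  have tr: "(t \<circ> r) \<longlonglongrightarrow> 0" using t(2) r by (rule LIMSEQ_subseq_LIMSEQ)
  have "l \<in> tangent_cone \<Gamma> y"
    unfolding tangent_cone_def
    using pl tr t(1)
    by (intro CollectI exI[of _ "p \<circ> r"] exI[of _ "t \<circ> r"]) (auto simp: o_def q[unfolded qp])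
  have "norm (c - l) \<le> norm (c - v)"
  proof (rule LIMSEQ_le)
    show "(\<lambda>k. norm (c - (p \<circ> r) k)) \<longlonglongrightarrow> norm (c - l)" by (intro tendsto_intros pl)
    show "(\<lambda>k. norm (c - (v' \<circ> r) k)) \<longlonglongrightarrow> norm (c - v)"
      by (intro tendsto_intros LIMSEQ_subseq_LIMSEQ[OF v' r])
  qed (use pc in auto)
  then have cl: "norm (\<epsilon> *\<^sub>R \<eta> - (l - v)) \<le> norm (\<epsilon> *\<^sub>R \<eta>)"
    by (simp add: c_def algebra_simps)
  have "norm (l - v) \<le> 2 * \<epsilon> * norm \<eta>"
    using cl norm_triangle_ineq4[of "\<epsilon> *\<^sub>R \<eta>" "\<epsilon> *\<^sub>R \<eta> - (l - v)"] \<epsilon> by simp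
  then have "\<eta> \<bullet> (l - v) \<le> M * (norm (l - v))\<^sup>2"
    using \<open>l \<in> _\<close> \<epsilon>\<eta> prox[of l] by (simp add: dist_norm)
  also have "\<dots> \<le> \<bar>M\<bar> * (norm (l - v))\<^sup>2" by (intro mult_right_mono) auto
  finally have "2 * \<epsilon> * (\<eta> \<bullet> (l - v)) \<le> 2 * \<epsilon> * (\<bar>M\<bar> * (norm (l - v))\<^sup>2)"
    using \<epsilon> by simp
  moreover have "(norm (l - v))\<^sup>2 \<le> 2 * \<epsilon> * (\<eta> \<bullet> (l - v))"
  proof -
    have "(norm (\<epsilon> *\<^sub>R \<eta> - (l - v)))\<^sup>2 \<le> (norm (\<epsilon> *\<^sub>R \<eta>))\<^sup>2" using cl by (simp add: power_mono)
    then show ?thesis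
      by (simp only: power2_norm_eq_inner inner_diff_left inner_diff_right inner_commute
          inner_scaleR_left inner_scaleR_right)
  qed
  \<comment> \<open>The squared distance is at most \<open>2 * \<epsilon> * \<bar>M\<bar>\<close>
    times itself, and this factor is below 1.\<close>
  ultimately have "(norm (l - v))\<^sup>2 * (1 - 2 * \<epsilon> * \<bar>M\<bar>) \<le> 0" by (simp add: algebra_simps)
  then have lv: "l = v" using \<epsilon>M by (simp add: mult_le_0_iff)
  define \<eta>' where "\<eta>' k = (c - p k) /\<^sub>R \<epsilon>" for k
  have "\<eta>' k \<in> regular_normal_cone \<Gamma> (y + t k *\<^sub>R p k)" for k
    unfolding qp[symmetric]
  \<comment> \<open>The proximal constant blows up as \<open>t k\<close> tends to 0. This is
    harmless, since regularity is needed for each \<open>k\<close> separately.\<close>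
  proof (rule proximal_normal_imp_regular_normal[OF q, where M = "1 / (2 * \<epsilon> * t k)"])
    fix q' assume "q' \<in> \<Gamma>"
    define s where "s = y + t k *\<^sub>R c - q k"
    have s: "\<eta>' k = (1 / (\<epsilon> * t k)) *\<^sub>R s"
      using t(1)[of k] \<epsilon> by (simp add: \<eta>'_def s_def qp divide_simps flip: scaleR_diff_right)
    have "(norm s)\<^sup>2 \<le> (norm (s - (q' - q k)))\<^sup>2"
      using qmin[OF \<open>q' \<in> \<Gamma>\<close>, of k] by (intro power_mono) (auto simp: s_def dist_norm)
    then have "s \<bullet> (q' - q k) \<le> (norm (q' - q k))\<^sup>2 / 2"
      unfolding power2_norm_eq_inner by (simp add: inner_diff_left inner_diff_right inner_commute)
    then show "\<eta>' k \<bullet> (q' - q k) \<le> 1 / (2 * \<epsilon> * t k) * (norm (q' - q k))\<^sup>2"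
      using t(1)[of k] \<epsilon> by (simp add: s divide_simps)
  qed
  moreover have "(\<lambda>k. \<eta>' (r k)) \<longlonglongrightarrow> (c - v) /\<^sub>R \<epsilon>"
    unfolding \<eta>'_def using pl by (intro tendsto_intros) (simp add: lv o_def)
  then have "(\<lambda>k. \<eta>' (r k)) \<longlonglongrightarrow> \<eta>" using \<epsilon> by (simp add: c_def)
  ultimately show ?thesis
    unfolding directional_normal_cone_def using pl tr t(1) lv
    by (intro CollectI exI[of _ "p \<circ> r"] exI[of _ "t \<circ> r"] exI[of _ "\<lambda>k. \<eta>' (r k)"]) auto
qed

section \<open>Localization and finite unions of tangent cones\<close>

lemma tangent_cone_mono_locally:
  assumes U: "open U" "z \<in> U" and sub: "S \<inter> U \<subseteq> T"
  shows "tangent_cone S z \<subseteq> tangent_cone T z"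
proof
  fix v assume "v \<in> tangent_cone S z"
  then obtain v' t where v': "v' \<longlonglongrightarrow> v" and t: "\<And>k. t k > 0" "t \<longlonglongrightarrow> 0"
    and mem: "\<And>k. z + t k *\<^sub>R v' k \<in> S"
    unfolding tangent_cone_def by auto
  have "(\<lambda>k. z + t k *\<^sub>R v' k) \<longlonglongrightarrow> z + 0 *\<^sub>R v" by (intro tendsto_intros t v')
  then have "\<forall>\<^sub>F k in sequentially. z + t k *\<^sub>R v' k \<in> U" using topological_tendstoD U by fastforce
  then obtain N where "\<And>k. k \<ge> N \<Longrightarrow> z + t k *\<^sub>R v' k \<in> U" unfolding eventually_sequentially by blast
  then have "\<forall>k. z + t (k + N) *\<^sub>R v' (k + N) \<in> T" using mem sub by auto
  then show "v \<in> tangent_cone T z"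
    unfolding tangent_cone_def using t LIMSEQ_ignore_initial_segment[OF t(2), of N]
      LIMSEQ_ignore_initial_segment[OF v', of N]
    by (intro CollectI exI[of _ "\<lambda>k. v' (k + N)"] exI[of _ "\<lambda>k. t (k + N)"]) auto
qed

lemma tangent_cone_nonempty_imp_mem:
  assumes "closed S" "v \<in> tangent_cone S z"
  shows "z \<in> S"
proof -
  obtain v' t where v': "v' \<longlonglongrightarrow> v" and t: "t \<longlonglongrightarrow> 0" and mem: "\<And>k. z + t k *\<^sub>R v' k \<in> S"
    using assms(2) unfolding tangent_cone_def by auto
  have "(\<lambda>k. z + t k *\<^sub>R v' k) \<longlonglongrightarrow> z + 0 *\<^sub>R v" by (intro tendsto_intros t v')
  then show ?thesis using closed_sequentially[OF assms(1)] mem by fastforce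
qed

text \<open>If \<open>v\<close> were tangent to no piece, each piece would be avoided near
  \<open>z\<close> in directions near \<open>v\<close> up to its own tolerance; the least of
  finitely many tolerances would then exclude the whole union.\<close>

lemma tangent_cone_finite_Union:
  assumes fin: "finite \<P>" and v: "v \<in> tangent_cone (\<Union>\<P>) z"
  shows "\<exists>P\<in>\<P>. v \<in> tangent_cone P z"
proof (rule ccontr)
  assume "\<not> ?thesis"
  then have "\<forall>P\<in>\<P>. \<exists>\<delta>>0. \<forall>t v'. 0 < t \<and> t < \<delta> \<and> dist v' v < \<delta> \<longrightarrow> z + t *\<^sub>R v' \<notin> P"
    unfolding tangent_cone_iff by meson
  then obtain \<delta> where \<delta>: "\<And>P. P \<in> \<P> \<Longrightarrow> \<delta> P > 0"
     "\<And>P t v'. P \<in> \<P> \<Longrightarrow> 0 < t \<Longrightarrow> t < \<delta> P \<Longrightarrow> dist v' v < \<delta> P \<Longrightarrow> z + t *\<^sub>R v' \<notin> P"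
    by metis
  \<comment> \<open>The inserted 1 keeps \<open>Min\<close> meaningful for an empty family.\<close>
  define r where "r = Min (insert 1 (\<delta> ` \<P>))"
  have r: "r > 0" "\<And>P. P \<in> \<P> \<Longrightarrow> r \<le> \<delta> P" using fin \<delta>(1) by (auto simp: r_def)
  then obtain t v' where tv: "0 < t" "t < r" "dist v' v < r" "z + t *\<^sub>R v' \<in> \<Union>\<P>"
    using v unfolding tangent_cone_iff by meson
  then obtain P where "P \<in> \<P>" "z + t *\<^sub>R v' \<in> P" by blast
  with \<delta>(2)[of P t v'] tv r(2)[of P] show False by force
qed

section \<open>Epigraph normals of smooth functions and first-order optimality\<close>

text \<open>A tangent direction \<open>(h, \<alpha>)\<close> to the epigraph rises at least as fast
  as the graph, so \<open>\<alpha>\<close> dominates the limit \<open>h \<bullet> g\<close> of the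
  difference quotients.\<close>

lemma GDERIV_imp_epigraph_regular_normal:
  fixes \<phi> :: "'a::real_inner \<Rightarrow> real"
  assumes g: "GDERIV \<phi> z :> g"
  shows "(g, -1) \<in> regular_normal_cone (epigraph UNIV \<phi>) (z, \<phi> z)"
proof -
  have "g \<bullet> h \<le> \<alpha>" if h: "(h, \<alpha>) \<in> tangent_cone (epigraph UNIV \<phi>) (z, \<phi> z)" for h \<alpha>
  proof -
    from h obtain v t where v: "v \<longlonglongrightarrow> (h, \<alpha>)" and t: "\<And>k. t k > 0" "t \<longlonglongrightarrow> 0"
      and mem: "\<And>k. (z, \<phi> z) + t k *\<^sub>R v k \<in> epigraph UNIV \<phi>"
      unfolding tangent_cone_def by auto
    have fst: "(\<lambda>k. fst (v k)) \<longlonglongrightarrow> h" and snd: "(\<lambda>k. snd (v k)) \<longlonglongrightarrow> \<alpha>"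
      using tendsto_fst[OF v] tendsto_snd[OF v] by simp_all
    have lim: "(\<lambda>k. (\<phi> (z + t k *\<^sub>R fst (v k)) - \<phi> z) /\<^sub>R t k) \<longlonglongrightarrow> h \<bullet> g"
      using has_derivative_sequential_quotient[OF _ fst t] g unfolding gderiv_def by blast
    have "(\<phi> (z + t k *\<^sub>R fst (v k)) - \<phi> z) /\<^sub>R t k \<le> snd (v k)" for k
    proof -
      have "\<phi> (z + t k *\<^sub>R fst (v k)) - \<phi> z \<le> t k * snd (v k)"
        using mem[of k] by (simp add: epigraph_def)
      then have "(\<phi> (z + t k *\<^sub>R fst (v k)) - \<phi> z) / t k \<le> snd (v k)"
        using t(1)[of k] by (subst pos_divide_le_eq) (auto simp only: mult.commute)
      then show ?thesis by (simp only: real_scaleR_def divide_inverse mult.commute)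
    qed
    then have "h \<bullet> g \<le> \<alpha>" by (intro LIMSEQ_le[OF lim snd]) blast
    then show ?thesis by (simp only: inner_commute)
  qed
  then show ?thesis
    by (auto simp: regular_normal_cone_def polar_cone_def mem_epigraph inner_prod_def)
qed

text \<open>On the ray \<open>z k = x + t k *\<^sub>R d\<close> the pairs
  \<open>(G (z k), -1)\<close> are regular normals to the epigraph at graph points, and they
  converge to \<open>(g, -1)\<close> by continuity of the gradient.\<close>

lemma gradient_in_directional_subdifferential:
  fixes \<phi> :: "'a::euclidean_space \<Rightarrow> real"
  assumes C1: "continuously_differentiable_around \<phi> x" and g: "GDERIV \<phi> x :> g"
  shows "g \<in> directional_subdifferential \<phi> x d"
proof -
  obtain U \<phi>' where U: "open U" "x \<in> U" and D: "\<And>z. z \<in> U \<Longrightarrow> (\<phi> has_derivative blinfun_apply (\<phi>' z)) (at z)"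
    and cont: "continuous_on U \<phi>'"
    using C1 unfolding continuously_differentiable_around_def continuously_differentiable_on_def by blast
  define G where "G z = (\<Sum>b\<in>Basis. blinfun_apply (\<phi>' z) b *\<^sub>R b)" for z
  have G: "GDERIV \<phi> z :> G z" if "z \<in> U" for z
    using D[OF that] unfolding G_def by (rule has_derivative_imp_GDERIV)
  have "G x = g" using GDERIV_unique G U g by blast
  have "continuous_on U G" unfolding G_def by (intro continuous_intros cont)
  then have Gx: "isCont G x" using U continuous_on_eq_continuous_at by blast
  have "(\<lambda>k. x + inverse (real (Suc k)) *\<^sub>R d) \<longlonglongrightarrow> x + 0 *\<^sub>R d"
    by (intro tendsto_intros LIMSEQ_inverse_real_of_nat)
  then have "\<forall>\<^sub>F k in sequentially. x + inverse (real (Suc k)) *\<^sub>R d \<in> U"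
    using topological_tendstoD U by fastforce
  then obtain N where N: "\<And>k. k \<ge> N \<Longrightarrow> x + inverse (real (Suc k)) *\<^sub>R d \<in> U"
    unfolding eventually_sequentially by blast
  \<comment> \<open>The shift by \<open>N\<close> places every \<open>z k\<close> in
    \<open>U\<close>, as the normal cone asks for membership at all indices.\<close>
  define t where "t k = inverse (real (Suc (k + N)))" for k
  have t: "t k > 0" for k by (simp add: t_def)
  have t0: "t \<longlonglongrightarrow> 0"
    unfolding t_def using LIMSEQ_ignore_initial_segment[OF LIMSEQ_inverse_real_of_nat] .
  define z where "z k = x + t k *\<^sub>R d" for k
  have zU: "z k \<in> U" for k unfolding z_def t_def by (rule N) simp
  have "z \<longlonglongrightarrow> x + 0 *\<^sub>R d" unfolding z_def by (intro tendsto_intros t0)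
  then have "(\<lambda>k. G (z k)) \<longlonglongrightarrow> g" using isCont_tendsto_compose[OF Gx, of z] \<open>G x = g\<close> by simp
  then have lim: "(\<lambda>k. (G (z k), -1 :: real)) \<longlonglongrightarrow> (g, -1)" by (intro tendsto_intros)
  \<comment> \<open>The second component is the difference quotient, so that
    \<open>(x, \<phi> x) + t k *\<^sub>R w k\<close> lies exactly on the graph.\<close>
  define w where "w k = (d, (\<phi> (z k) - \<phi> x) /\<^sub>R t k)" for k
  have "(\<lambda>k. (\<phi> (z k) - \<phi> x) /\<^sub>R t k) \<longlonglongrightarrow> blinfun_apply (\<phi>' x) d"
    unfolding z_def by (rule has_derivative_sequential_quotient[OF D[OF U(2)] tendsto_const t t0])
  then have "w \<longlonglongrightarrow> (d, dir_deriv \<phi> x d)"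
    unfolding w_def dir_deriv_eq_derivative[OF D[OF U(2)]] by (intro tendsto_intros)
  moreover have "(x, \<phi> x) + t k *\<^sub>R w k = (z k, \<phi> (z k))" for k
    using t[of k] by (simp add: w_def z_def flip: mult.assoc)
  then have "(G (z k), -1) \<in> regular_normal_cone (epigraph UNIV \<phi>) ((x, \<phi> x) + t k *\<^sub>R w k)" for k
    using GDERIV_imp_epigraph_regular_normal[OF G[OF zU]] by simp
  ultimately show ?thesis
    unfolding directional_subdifferential_def directional_normal_cone_def using t t0 lim
    by (intro CollectI exI[of _ w] exI[of _ t] exI[of _ "\<lambda>k. (G (z k), -1)"]) auto
qed

lemma continuously_differentiable_around_inner:
  assumes "continuously_differentiable_around F x"
  shows "continuously_differentiable_around (\<lambda>y. \<mu> \<bullet> F y) x"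
proof -
  obtain U F' where U: "open U" "x \<in> U" and D: "\<And>z. z \<in> U \<Longrightarrow> (F has_derivative blinfun_apply (F' z)) (at z)"
    and cont: "continuous_on U F'"
    using assms unfolding continuously_differentiable_around_def continuously_differentiable_on_def by blast
  have "((\<lambda>y. \<mu> \<bullet> F y) has_derivative blinfun_apply (blinfun_inner_right \<mu> o\<^sub>L F' z)) (at z)" if "z \<in> U" for z
    by (auto intro!: derivative_eq_intros D that)
  moreover have "continuous_on U (\<lambda>z. blinfun_inner_right \<mu> o\<^sub>L F' z)"
    by (intro continuous_intros cont)
  ultimately have "continuously_differentiable_on (\<lambda>y. \<mu> \<bullet> F y) U"
    unfolding continuously_differentiable_on_def
    by (intro exI[of _ "\<lambda>z. blinfun_inner_right \<mu> o\<^sub>L F' z"]) auto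
  with U show ?thesis unfolding continuously_differentiable_around_def by blast
qed

text \<open>Along a feasible sequence that realizes a tangent vector \<open>v\<close>, the
  difference quotients of \<open>f\<close> are eventually nonnegative and tend to
  \<open>v \<bullet> g\<close>. GGCQ later transfers this to the linearization cone.\<close>

lemma local_minimizer_imp_regular_normal:
  fixes f :: "'a::real_inner \<Rightarrow> real"
  assumes min: "local_minimizer f F \<Gamma> x" and g: "GDERIV f x :> g"
  shows "- g \<in> regular_normal_cone (feasible_set F \<Gamma>) x"
proof -
  obtain r where r: "r > 0" "\<And>y. y \<in> feasible_set F \<Gamma> \<Longrightarrow> y \<in> ball x r \<Longrightarrow> f x \<le> f y"
    and x: "x \<in> feasible_set F \<Gamma>"
    using min unfolding local_minimizer_def by blast
  have "0 \<le> v \<bullet> g" if v: "v \<in> tangent_cone (feasible_set F \<Gamma>) x" for v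
  proof -
    from v obtain v' t where v': "v' \<longlonglongrightarrow> v" and t: "\<And>k. t k > 0" "t \<longlonglongrightarrow> 0"
      and mem: "\<And>k. x + t k *\<^sub>R v' k \<in> feasible_set F \<Gamma>"
      unfolding tangent_cone_def by auto
    have "(\<lambda>k. (f (x + t k *\<^sub>R v' k) - f x) /\<^sub>R t k) \<longlonglongrightarrow> v \<bullet> g"
      using has_derivative_sequential_quotient[OF _ v' t] g unfolding gderiv_def by blast
    moreover have "(\<lambda>k. x + t k *\<^sub>R v' k) \<longlonglongrightarrow> x + 0 *\<^sub>R v" by (intro tendsto_intros t v')
    then have "\<forall>\<^sub>F k in sequentially. x + t k *\<^sub>R v' k \<in> ball x r"
      by (rule topological_tendstoD) (use r in auto)
    then have "\<forall>\<^sub>F k in sequentially. 0 \<le> (f (x + t k *\<^sub>R v' k) - f x) /\<^sub>R t k"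
    proof eventually_elim
      case (elim k)
      then show ?case using r(2)[OF mem elim] t(1)[of k] by simp
    qed
    ultimately show ?thesis by (rule tendsto_lowerbound) simp
  qed
  with x show ?thesis by (auto simp: regular_normal_cone_def polar_cone_def inner_commute)
qed

section \<open>Error bounds\<close>

text \<open>Active constraints do not increase along \<open>v\<close>, and inactive ones have slack
  for a positive step length. With finitely many constraints the least of these lengths is
  positive.\<close>

lemma finite_constraints_feasible_direction:
  fixes a :: "'i \<Rightarrow> 'a::real_inner"
  assumes I: "finite I" and p: "\<And>i. i \<in> I \<Longrightarrow> a i \<bullet> p \<le> b i"
    and v: "\<And>i. i \<in> I \<Longrightarrow> a i \<bullet> p = b i \<Longrightarrow> a i \<bullet> v \<le> 0"
  shows "\<exists>s>0. \<forall>t. 0 < t \<and> t \<le> s \<longrightarrow> (\<forall>i\<in>I. a i \<bullet> (p + t *\<^sub>R v) \<le> b i)"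
proof -
  have "\<forall>i\<in>I. \<exists>s>0. \<forall>t. 0 < t \<and> t \<le> s \<longrightarrow> a i \<bullet> (p + t *\<^sub>R v) \<le> b i"
  proof
    fix i assume i: "i \<in> I"
    show "\<exists>s>0. \<forall>t. 0 < t \<and> t \<le> s \<longrightarrow> a i \<bullet> (p + t *\<^sub>R v) \<le> b i"
    proof (cases "a i \<bullet> p = b i")
      case True
      with v[OF i] show ?thesis
        by (intro exI[of _ 1]) (auto simp: inner_add_right mult_nonneg_nonpos)
    next
      case False
      then have lt: "a i \<bullet> p < b i" using p[OF i] by simp
      \<comment> \<open>The summand 1 in the denominator covers
        \<open>a i \<bullet> v = 0\<close>.\<close>
      have "a i \<bullet> (p + t *\<^sub>R v) \<le> b i" if "0 < t" "t \<le> (b i - a i \<bullet> p) / (\<bar>a i \<bullet> v\<bar> + 1)" for t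
      proof -
        have "t * (\<bar>a i \<bullet> v\<bar> + 1) \<le> b i - a i \<bullet> p"
          using that by (simp add: pos_le_divide_eq)
        moreover have "t * (a i \<bullet> v) \<le> t * (\<bar>a i \<bullet> v\<bar> + 1)"
          using that by (intro mult_left_mono) auto
        ultimately show ?thesis by (simp add: inner_add_right)
      qed
      moreover have "(b i - a i \<bullet> p) / (\<bar>a i \<bullet> v\<bar> + 1) > 0" using lt by (intro divide_pos_pos) auto
      ultimately show ?thesis by blast
    qed
  qed
  then obtain s where s: "\<And>i. i \<in> I \<Longrightarrow> s i > 0"
     "\<And>i t. i \<in> I \<Longrightarrow> 0 < t \<Longrightarrow> t \<le> s i \<Longrightarrow> a i \<bullet> (p + t *\<^sub>R v) \<le> b i"
    by metis
  define r where "r = Min (insert 1 (s ` I))"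
  have "r > 0" "\<And>i. i \<in> I \<Longrightarrow> r \<le> s i" using I s(1) by (auto simp: r_def)
  then show ?thesis using s(2) by (intro exI[of _ r]) force
qed

text \<open>Both sides are positively homogeneous, so unit vectors suffice. There the total
  violation is continuous and positive: a vector without violation would lie in the cone and in its
  polar, hence be orthogonal to itself. Compactness supplies the minimum \<open>m\<close>.\<close>

lemma polyhedral_cone_normal_bound:
  fixes C :: "'a::euclidean_space set"
  assumes C: "finite C"
  shows "\<exists>m>0. \<forall>w \<in> polar_cone {v. \<forall>c\<in>C. c \<bullet> v \<le> 0}. m * norm w \<le> (\<Sum>c\<in>C. max 0 (c \<bullet> w))"
proof -
  define K where "K = {v. \<forall>c\<in>C. c \<bullet> v \<le> 0}"
  define S where "S = polar_cone K \<inter> sphere 0 1"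
  define h where "h w = (\<Sum>c\<in>C. max 0 (c \<bullet> w))" for w
  have "polar_cone K = (\<Inter>v\<in>K. {w. w \<bullet> v \<le> 0})" by (auto simp: polar_cone_def)
  moreover have "closed \<dots>" by (intro closed_INT ballI closed_Collect_le continuous_intros)
  ultimately have "compact S" by (auto simp: S_def)
  moreover have "continuous_on S h" unfolding h_def by (intro continuous_intros)
  moreover have hpos: "h w > 0" if "w \<in> S" for w
  proof (rule ccontr)
    assume "\<not> h w > 0"
    then have "h w = 0" by (simp add: h_def sum_nonneg order_antisym)
    then have "\<forall>c\<in>C. max 0 (c \<bullet> w) = 0"
      unfolding h_def by (subst (asm) sum_nonneg_eq_0_iff) (auto simp: C)
    then have "w \<in> K" by (auto simp: K_def max_def split: if_splits)
    then have "w \<bullet> w \<le> 0" using that by (auto simp: S_def polar_cone_def)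
    moreover have "w \<bullet> w = 1" using that by (simp add: S_def dot_square_norm)
    ultimately show False by simp
  qed
  ultimately obtain m where m: "m > 0" "\<And>w. w \<in> S \<Longrightarrow> m \<le> h w"
  \<comment> \<open>For a trivial polar cone there is no unit vector to minimize over, and
    \<open>m = 1\<close> is taken.\<close>
  proof (cases "S = {}")
    case False
    with \<open>compact S\<close> \<open>continuous_on S h\<close> obtain w where "w \<in> S" "\<forall>v\<in>S. h w \<le> h v"
      using continuous_attains_inf by blast
    then show ?thesis using that hpos by blast
  qed (use that[of 1] in auto)
  have "m * norm w \<le> h w" if w: "w \<in> polar_cone K" for w
  proof (cases "w = 0")
    case False
    have "w /\<^sub>R norm w \<in> S"
      using w False by (auto simp: S_def polar_cone_def mult_nonneg_nonpos)
    then have "m \<le> h (w /\<^sub>R norm w)" by (rule m)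
    also have "h (w /\<^sub>R norm w) = h w / norm w"
      unfolding h_def sum_divide_distrib
      using False by (intro sum.cong) (auto simp: max_def divide_simps)
    finally show ?thesis using False by (simp add: field_simps)
  qed (simp add: h_def)
  then show ?thesis using m(1) unfolding K_def h_def by blast
qed

text \<open>The displacement \<open>u - p\<close> to the nearest point \<open>p\<close> is normal to the cone cut out by the
  constraints active at \<open>p\<close>, and there are only finitely many such cones.\<close>

lemma hoffman_bound_cone:
  fixes C :: "'a::euclidean_space set"
  assumes C: "finite C"
  shows "\<exists>\<kappa>\<ge>0. \<forall>u. infdist u {v. \<forall>c\<in>C. c \<bullet> v \<le> 0} \<le> \<kappa> * (\<Sum>c\<in>C. max 0 (c \<bullet> u))"
proof -
  define K where "K J = {v :: 'a. \<forall>c\<in>J. c \<bullet> v \<le> 0}" for J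
  have "\<exists>m>0. \<forall>w \<in> polar_cone (K J). m * norm w \<le> (\<Sum>c\<in>J. max 0 (c \<bullet> w))" if "J \<in> Pow C" for J
    unfolding K_def using polyhedral_cone_normal_bound[of J] that C finite_subset by blast
  then obtain m where m: "\<And>J. J \<in> Pow C \<Longrightarrow> m J > 0"
    "\<And>J w. J \<in> Pow C \<Longrightarrow> w \<in> polar_cone (K J) \<Longrightarrow> m J * norm w \<le> (\<Sum>c\<in>J. max 0 (c \<bullet> w))"
    by metis
  \<comment> \<open>The active set depends on \<open>u\<close>, but the least constant over all
    subsets of \<open>C\<close> serves every \<open>u\<close>.\<close>
  define \<mu> where "\<mu> = Min (m ` Pow C)"
  have \<mu>: "\<mu> > 0" unfolding \<mu>_def using C m(1) by (subst Min_gr_iff) auto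
  have \<mu>le: "\<mu> \<le> m J" if "J \<in> Pow C" for J using C that by (auto simp: \<mu>_def)
  have K_Inter: "K C = (\<Inter>c\<in>C. {v. c \<bullet> v \<le> 0})" by (auto simp: K_def)
  have conv: "convex (K C)" unfolding K_Inter by (auto intro: convex_INT convex_halfspace_le)
  have cl: "closed (K C)" unfolding K_Inter by (auto intro: closed_halfspace_le)
  have "infdist u (K C) \<le> inverse \<mu> * (\<Sum>c\<in>C. max 0 (c \<bullet> u))" for u
  proof -
    have "0 \<in> K C" by (simp add: K_def)
    then obtain p where p: "p \<in> K C" and min: "\<And>q. q \<in> K C \<Longrightarrow> dist u p \<le> dist u q"
      using distance_attains_inf[OF cl] by blast
    define J where "J = {c \<in> C. c \<bullet> p = 0}"
    have J: "J \<in> Pow C" by (auto simp: J_def)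
    have "u - p \<in> polar_cone (K J)"
      unfolding polar_cone_def
    proof (intro CollectI ballI)
      fix v assume v: "v \<in> K J"
      \<comment> \<open>A short step from \<open>p\<close> along \<open>v\<close> stays in
        \<open>K C\<close>, so the obtuse angle property of the projection applies to its
        endpoint.\<close>
      have "\<exists>s>0. \<forall>t. 0 < t \<and> t \<le> s \<longrightarrow> (\<forall>c\<in>C. c \<bullet> (p + t *\<^sub>R v) \<le> 0)"
        by (rule finite_constraints_feasible_direction[OF C]) (use p v in \<open>auto simp: K_def J_def\<close>)
      then obtain t where t: "t > 0" "p + t *\<^sub>R v \<in> K C" by (auto simp: K_def)
      then have "(u - p) \<bullet> (p + t *\<^sub>R v - p) \<le> 0"
        using any_closest_point_dot[OF conv cl p t(2)] min by blast
      then show "(u - p) \<bullet> v \<le> 0" using t(1) by (simp add: mult_le_0_iff)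
    qed
    then have "m J * norm (u - p) \<le> (\<Sum>c\<in>J. max 0 (c \<bullet> (u - p)))" using m(2)[OF J] by blast
    \<comment> \<open>Active constraints vanish at \<open>p\<close>, so their violations at
      \<open>u - p\<close> and at \<open>u\<close> agree.\<close>
    also have "\<dots> = (\<Sum>c\<in>J. max 0 (c \<bullet> u))" by (intro sum.cong) (auto simp: J_def inner_diff_right)
    also have "\<dots> \<le> (\<Sum>c\<in>C. max 0 (c \<bullet> u))" using C by (intro sum_mono2) (auto simp: J_def)
    finally have "\<mu> * norm (u - p) \<le> (\<Sum>c\<in>C. max 0 (c \<bullet> u))"
      using mult_right_mono[OF \<mu>le[OF J] norm_ge_zero[of "u - p"]] by linarith
    moreover have "infdist u (K C) \<le> norm (u - p)" using infdist_le[OF p] by (simp add: dist_norm)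
    then have "\<mu> * infdist u (K C) \<le> \<mu> * norm (u - p)" using \<mu> by simp
    ultimately have "\<mu> * infdist u (K C) \<le> (\<Sum>c\<in>C. max 0 (c \<bullet> u))" by linarith
    then show ?thesis using \<mu> by (simp add: field_simps)
  qed
  then show ?thesis using \<mu> unfolding K_def by (intro exI[of _ "inverse \<mu>"]) auto
qed

section \<open>Polyhedral constraint sets\<close>

text \<open>\<open>C\<close> consists of the normals of the constraints active at \<open>y\<close>.
  They bound every tangent vector, while a vector that satisfies them admits a whole segment from
  \<open>y\<close> inside \<open>P\<close>.\<close>

lemma polyhedron_tangent_cone:
  fixes P :: "'a::euclidean_space set"
  assumes P: "polyhedron P" and y: "y \<in> P"
  shows "\<exists>C. finite C \<and> tangent_cone P y = {v. \<forall>c\<in>C. c \<bullet> v \<le> 0}"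
proof -
  obtain H where H: "finite H" "P = \<Inter>H" "\<And>h. h \<in> H \<Longrightarrow> \<exists>a b. h = {x. a \<bullet> x \<le> b}"
    using P unfolding polyhedron_def by metis
  then obtain a b where ab: "\<And>h. h \<in> H \<Longrightarrow> h = {x. a h \<bullet> x \<le> b h}" by metis
  then have mem: "z \<in> P \<longleftrightarrow> (\<forall>h\<in>H. a h \<bullet> z \<le> b h)" for z using H(2) by blast
  define C where "C = a ` {h \<in> H. a h \<bullet> y = b h}"
  have 1: "c \<bullet> v \<le> 0" if v: "v \<in> tangent_cone P y" and "c \<in> C" for v c
  proof -
    from v obtain v' t where v': "v' \<longlonglongrightarrow> v" and t: "\<And>k. t k > 0"
      and P: "\<And>k. y + t k *\<^sub>R v' k \<in> P"
      unfolding tangent_cone_def by auto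
    have "t k * (c \<bullet> v' k) \<le> 0" for k
      using P[of k] \<open>c \<in> C\<close> by (auto simp: mem C_def inner_add_right)
    then have "c \<bullet> v' k \<le> 0" for k using t by (meson mult_pos_pos not_le)
    moreover have "(\<lambda>k. c \<bullet> v' k) \<longlonglongrightarrow> c \<bullet> v" by (intro tendsto_intros v')
    ultimately show ?thesis by (metis LIMSEQ_le_const2)
  qed
  have 2: "\<exists>s>0. \<forall>t. 0 < t \<and> t \<le> s \<longrightarrow> y + t *\<^sub>R v \<in> P" if v: "\<forall>c\<in>C. c \<bullet> v \<le> 0" for v
    unfolding mem by (rule finite_constraints_feasible_direction[OF H(1)])
      (use y v in \<open>auto simp: mem C_def\<close>)
  have 3: "v \<in> tangent_cone P y" if v: "\<forall>c\<in>C. c \<bullet> v \<le> 0" for v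
  proof -
    obtain s where s: "s > 0" "\<And>t. 0 < t \<Longrightarrow> t \<le> s \<Longrightarrow> y + t *\<^sub>R v \<in> P" using 2[OF v] by blast
    have "(\<lambda>k. s * inverse (real (Suc k))) \<longlonglongrightarrow> s * 0"
      by (intro tendsto_mult tendsto_const LIMSEQ_inverse_real_of_nat)
    moreover have "s * inverse (real (Suc k)) \<le> s" for k
      using s(1) by (simp add: field_simps)
    ultimately show ?thesis
      unfolding tangent_cone_def using s
      by (intro CollectI exI[of _ "\<lambda>_. v"] exI[of _ "\<lambda>k. s * inverse (real (Suc k))"]) auto
  qed
  have "finite C" using H(1) by (simp add: C_def)
  with 1 3 show ?thesis by (intro exI[of _ C]) blast
qed

text \<open>The tangent cone is the union of the tangent cones of the pieces through
  \<open>y\<close>. For \<open>v\<close> in one of these, the distance from \<open>u\<close> to the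
  preimage of that cone already satisfies a Hoffman bound, and the full preimage is only
  larger.\<close>

lemma polyhedral_linear_error_bound:
  fixes \<Gamma> :: "'b::euclidean_space set" and A :: "'a::euclidean_space \<Rightarrow> 'b"
  assumes poly: "locally_around polyhedral \<Gamma> y" and A: "linear A"
  shows "\<exists>\<kappa>\<ge>0. \<forall>u. \<forall>v\<in>tangent_cone \<Gamma> y.
           infdist u {u. A u \<in> tangent_cone \<Gamma> y} \<le> \<kappa> * norm (A u - v)"
proof -
  obtain U \<P> where U: "open U" "y \<in> U" and P: "finite \<P>" "\<And>P. P \<in> \<P> \<Longrightarrow> polyhedron P"
    and eq: "\<Gamma> \<inter> U = \<Union>\<P> \<inter> U"
    using poly unfolding locally_around_def polyhedral_def by blast
  define T where "T = tangent_cone \<Gamma> y"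
  \<comment> \<open>Pieces that miss \<open>y\<close> are closed and contribute no tangent vectors
    at \<open>y\<close>.\<close>
  define \<Q> where "\<Q> = {P \<in> \<P>. y \<in> P}"
  have sub: "tangent_cone P y \<subseteq> T" if "P \<in> \<Q>" for P
    unfolding T_def using that eq by (intro tangent_cone_mono_locally[OF U]) (auto simp: \<Q>_def)
  have cover: "\<exists>P\<in>\<Q>. v \<in> tangent_cone P y" if v: "v \<in> T" for v
  proof -
    have "T \<subseteq> tangent_cone (\<Union>\<P>) y"
      unfolding T_def using eq by (intro tangent_cone_mono_locally[OF U]) auto
    then obtain P' where "P' \<in> \<P>" "v \<in> tangent_cone P' y"
      using tangent_cone_finite_Union[OF P(1)] v by blast
    moreover from this have "y \<in> P'"
      using tangent_cone_nonempty_imp_mem P(2) polyhedron_imp_closed by blast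
    ultimately show ?thesis by (auto simp: \<Q>_def)
  qed
  have "\<exists>\<kappa>\<ge>0. \<forall>u. \<forall>v\<in>tangent_cone P y. infdist u {u. A u \<in> T} \<le> \<kappa> * norm (A u - v)"
    if "P \<in> \<Q>" for P
  proof -
    have "polyhedron P" "y \<in> P" using that P(2) by (auto simp: \<Q>_def)
    from polyhedron_tangent_cone[OF this] obtain C
      where C: "finite C" and K: "tangent_cone P y = {v. \<forall>c\<in>C. c \<bullet> v \<le> 0}"
      by (elim exE conjE)
    \<comment> \<open>The adjoint pulls the constraints back to \<open>u\<close>, so the preimage of
      the cone is again cut out by finitely many homogeneous inequalities.\<close>
    have adj: "adjoint A c \<bullet> u = c \<bullet> A u" for c u
      using adjoint_works[OF A, of u c] by (simp add: inner_commute)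
    define L where "L = {u. \<forall>c\<in>adjoint A ` C. c \<bullet> u \<le> 0}"
    have L: "L = {u. A u \<in> tangent_cone P y}" by (auto simp: L_def K adj)
    obtain \<kappa> where \<kappa>: "\<kappa> \<ge> 0" "\<And>u. infdist u L \<le> \<kappa> * (\<Sum>c\<in>adjoint A ` C. max 0 (c \<bullet> u))"
      using hoffman_bound_cone[of "adjoint A ` C"] C unfolding L_def by blast
    have "infdist u {u. A u \<in> T} \<le> \<kappa> * (\<Sum>c\<in>C. norm c) * norm (A u - v)"
      if v: "v \<in> tangent_cone P y" for u v
    proof -
      have "0 \<in> L" by (simp add: L_def)
      then have "infdist u {u. A u \<in> T} \<le> infdist u L"
        using sub[OF \<open>P \<in> \<Q>\<close>] by (intro infdist_mono) (auto simp: L)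
      also note \<kappa>(2)
      \<comment> \<open>Only an inequality: the adjoint may identify several constraints, which the
        sum over the image counts once.\<close>
      also have "(\<Sum>c\<in>adjoint A ` C. max 0 (c \<bullet> u)) \<le> (\<Sum>c\<in>C. max 0 (c \<bullet> A u))"
        using sum_image_le[OF C, of "\<lambda>c. max 0 (c \<bullet> u)" "adjoint A"] by (simp add: adj o_def)
      also have "\<dots> \<le> (\<Sum>c\<in>C. norm c * norm (A u - v))"
      proof (rule sum_mono)
        fix c assume "c \<in> C"
        then have "c \<bullet> v \<le> 0" using v by (simp add: K)
        \<comment> \<open>Subtracting \<open>v\<close>, which satisfies the constraint, turns the
          violation into a multiple of the residual.\<close>
        then have "c \<bullet> A u \<le> c \<bullet> (A u - v)" by (simp add: inner_diff_right)
        also have "\<dots> \<le> norm c * norm (A u - v)" by (rule norm_cauchy_schwarz)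
        finally show "max 0 (c \<bullet> A u) \<le> norm c * norm (A u - v)" by simp
      qed
      finally show ?thesis
        using \<kappa>(1) by (simp add: sum_distrib_right mult.assoc mult_left_mono)
    qed
    then show ?thesis using \<kappa>(1)
      by (intro exI[of _ "\<kappa> * (\<Sum>c\<in>C. norm c)"]) (auto simp: sum_nonneg)
  qed
  then obtain \<kappa> where \<kappa>: "\<And>P. P \<in> \<Q> \<Longrightarrow> \<kappa> P \<ge> 0"
     "\<And>P u v. P \<in> \<Q> \<Longrightarrow> v \<in> tangent_cone P y \<Longrightarrow> infdist u {u. A u \<in> T} \<le> \<kappa> P * norm (A u - v)"
    by metis
  have "finite \<Q>" using P(1) by (simp add: \<Q>_def)
  have "infdist u {u. A u \<in> T} \<le> (\<Sum>P\<in>\<Q>. \<kappa> P) * norm (A u - v)" if v: "v \<in> T" for u v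
  proof -
    obtain P where P: "P \<in> \<Q>" "v \<in> tangent_cone P y" using cover v by blast
    have "\<kappa> P \<le> (\<Sum>P\<in>\<Q>. \<kappa> P)" using \<open>finite \<Q>\<close> \<kappa>(1) P(1) by (intro member_le_sum) auto
    then show ?thesis using \<kappa>(2)[OF P, of u] by (meson mult_right_mono norm_ge_zero order_trans)
  qed
  moreover have "(\<Sum>P\<in>\<Q>. \<kappa> P) \<ge> 0" using \<kappa>(1) by (rule sum_nonneg)
  ultimately show ?thesis unfolding T_def by blast
qed

section \<open>Directional metric subregularity\<close>

lemma closed_linear_preimage_tangent_cone:
  assumes "bounded_linear A"
  shows "closed {u. A u \<in> tangent_cone \<Gamma> y}"
proof -
  have "closed (A -` tangent_cone \<Gamma> y)"
    by (intro continuous_closed_vimage closed_tangent_cone linear_continuous_at assms)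
  then show ?thesis by (simp only: vimage_def)
qed

text \<open>Subregularity speaks about small vectors close to the ray through \<open>d\<close>.
  Since the tangent cone and its preimage are invariant under positive scaling, the estimate at
  \<open>s *\<^sub>R u\<close> can be scaled back to \<open>u\<close> near \<open>d\<close>.\<close>

lemma subregular_linear_error_bound:
  fixes F :: "'a::euclidean_space \<Rightarrow> 'b::euclidean_space"
  assumes sub: "metrically_subregular_in_direction (linearized_feasibility_map F \<Gamma> x) d 0 0"
    and D: "(F has_derivative A) (at x)" and d: "norm d = 1"
  shows "\<exists>r>0. \<exists>\<kappa>\<ge>0. \<forall>u\<in>cball d r. \<forall>v\<in>tangent_cone \<Gamma> (F x).
           infdist u {u. A u \<in> tangent_cone \<Gamma> (F x)} \<le> \<kappa> * norm (A u - v)"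
proof -
  define T where "T = tangent_cone \<Gamma> (F x)"
  define L where "L = {u. A u \<in> T}"
  define Y where "Y u = {A u - v | v. v \<in> T}" for u
  have bl: "bounded_linear A" using D by (rule has_derivative_bounded_linear)
  then interpret A: bounded_linear A .
  have "frechet_derivative F (at x) = A" using D by (metis frechet_derivative_at)
  then have Y: "linearized_feasibility_map F \<Gamma> x = Y"
    by (auto simp: fun_eq_iff linearized_feasibility_map_def Y_def T_def)
  have L: "{u. 0 \<in> Y u} = L" by (auto simp: Y_def L_def)
  obtain \<epsilon> \<delta> \<kappa> where pos: "\<epsilon> > 0" "\<delta> > 0" "\<kappa> > 0" and "0 \<in> Y 0"
    and bound: "\<And>u. u \<in> directional_ball \<epsilon> \<delta> d \<Longrightarrow> Y u \<noteq> {} \<Longrightarrow> infdist u L \<le> \<kappa> * infdist 0 (Y u)"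
    using sub unfolding metrically_subregular_in_direction_def Y L by auto
  have "closed L" unfolding L_def T_def by (rule closed_linear_preimage_tangent_cone[OF bl])
  have "L \<noteq> {}" using \<open>0 \<in> Y 0\<close> by (auto simp: L[symmetric])
  \<comment> \<open>The bound 1/2 keeps \<open>norm u\<close> between 1/2 and 3/2. The bound
    \<open>\<delta> / 4\<close> makes the deviation of \<open>u\<close> from
    \<open>norm u *\<^sub>R d\<close>, which is at most \<open>2 * norm (u - d)\<close>, no larger
    than \<open>\<delta> * norm u\<close>.\<close>
  define r where "r = min (1/2) (\<delta> / 4)"
  have "infdist u L \<le> \<kappa> * norm (A u - v)" if u: "u \<in> cball d r" and v: "v \<in> T" for u v
  proof -
    define s where "s = \<epsilon> / 2"
    have s: "s > 0" using pos by (simp add: s_def)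
    have ud: "norm (u - d) \<le> 1/2" "norm (u - d) \<le> \<delta> / 4"
      using u by (auto simp: r_def dist_norm norm_minus_commute)
    have dn: "\<bar>1 - norm u\<bar> \<le> norm (u - d)" using norm_triangle_ineq3[of d u] d by (simp add: norm_minus_commute)
    have "norm (u - norm u *\<^sub>R d) \<le> norm (u - d) + norm ((1 - norm u) *\<^sub>R d)"
      using norm_triangle_ineq[of "u - d" "(1 - norm u) *\<^sub>R d"] by (simp add: algebra_simps)
    also have "\<dots> \<le> \<delta> / 2" using dn ud d by simp
    also have "\<dots> \<le> \<delta> * norm u" using dn ud pos by simp
    finally have "norm (u - norm u *\<^sub>R d) \<le> \<delta> * norm u" .
    moreover have "s *\<^sub>R u - norm (s *\<^sub>R u) *\<^sub>R d = s *\<^sub>R (u - norm u *\<^sub>R d)"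
      using s by (simp add: algebra_simps)
    ultimately have "norm (s *\<^sub>R u - norm (s *\<^sub>R u) *\<^sub>R d) \<le> \<delta> * norm (s *\<^sub>R u)"
      using s by simp
    moreover have "norm (s *\<^sub>R u) \<le> \<epsilon>" using dn ud pos by (simp add: s_def)
    ultimately have "s *\<^sub>R u \<in> directional_ball \<epsilon> \<delta> d" by (simp add: directional_ball_def d)
    \<comment> \<open>This element shows that the image is nonempty, as the subregularity estimate
      requires, and bounds its distance to 0.\<close>
    moreover have mem: "A (s *\<^sub>R u) - s *\<^sub>R v \<in> Y (s *\<^sub>R u)"
      using tangent_cone_scaleR[OF v[unfolded T_def] s] unfolding Y_def T_def by blast
    ultimately have "infdist (s *\<^sub>R u) L \<le> \<kappa> * infdist 0 (Y (s *\<^sub>R u))" by (intro bound) auto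
    also have "\<dots> \<le> \<kappa> * norm (A (s *\<^sub>R u) - s *\<^sub>R v)"
      using infdist_le[OF mem, of 0] pos by (intro mult_left_mono) auto
    also have "A (s *\<^sub>R u) - s *\<^sub>R v = s *\<^sub>R (A u - v)" by (simp add: A.scaleR algebra_simps)
    finally have *: "infdist (s *\<^sub>R u) L \<le> s * (\<kappa> * norm (A u - v))" using s by (simp add: mult.left_commute)
    obtain p where p: "p \<in> L" "infdist (s *\<^sub>R u) L = dist (s *\<^sub>R u) p"
      using infdist_attains_inf[OF \<open>closed L\<close> \<open>L \<noteq> {}\<close>] by blast
    have "p /\<^sub>R s \<in> L"
      using p(1) tangent_cone_scaleR[of "A p" \<Gamma> "F x" "inverse s"] s
      by (simp add: L_def T_def A.scaleR)
    then have "infdist u L \<le> dist u (p /\<^sub>R s)" by (rule infdist_le)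
    also have "\<dots> = dist (s *\<^sub>R u) p / s"
    proof -
      have "s *\<^sub>R u - p = s *\<^sub>R (u - p /\<^sub>R s)" using s by (simp add: algebra_simps)
      then show ?thesis using s by (simp add: dist_norm)
    qed
    also have "\<dots> \<le> \<kappa> * norm (A u - v)" using * p(2) s by (simp add: field_simps)
    finally show ?thesis .
  qed
  moreover have "r > 0" using pos by (simp add: r_def)
  ultimately show ?thesis using pos unfolding L_def T_def
    by (intro exI[of _ r] conjI exI[of _ \<kappa>]) auto
qed

section \<open>Multipliers\<close>

text \<open>Minimizes a quadratic penalization of the constraint \<open>A u = v\<close>; the error bound on \<open>g\<close> keeps
  the penalty multiplier bounded.\<close>

lemma penalized_multiplier:
  fixes A :: "'a::euclidean_space \<Rightarrow> 'b::euclidean_space"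
  assumes A: "bounded_linear A" and T: "closed T" and d: "A d \<in> T"
    and r: "r > 0" and C: "C \<ge> 0"
    and bound: "\<And>u v. u \<in> cball d r \<Longrightarrow> v \<in> T \<Longrightarrow> g \<bullet> (u - d) \<le> C * norm (A u - v)"
    and \<delta>: "\<delta> > 0"
  shows "\<exists>v\<in>T. \<exists>\<mu> M. dist v (A d) < \<delta> \<and> norm \<mu> \<le> 2 * C + \<delta> \<and>
           (\<forall>h. \<bar>\<mu> \<bullet> A h - g \<bullet> h\<bar> \<le> \<delta> * norm h) \<and>
           (\<forall>p\<in>T. dist p v < 1/2 \<longrightarrow> \<mu> \<bullet> (p - v) \<le> M * (norm (p - v))\<^sup>2)"
proof -
  interpret A: bounded_linear A by (rule A)
  obtain K where K: "K > 0" "\<And>h. norm (A h) \<le> norm h * K" using A.pos_bounded by blast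
  \<comment> \<open>This is the target distance of the minimizer from \<open>(d, A d)\<close>: it
    keeps \<open>u\<close> interior to the ball, leaves room 1/2 around \<open>v\<close>, and
    ensures \<open>\<epsilon> * (1 + K) \<le> \<delta>\<close> for the stationarity error.\<close>
  define \<epsilon> where "\<epsilon> = min (min r 1) (\<delta> / (1 + K)) / 2"
  have \<epsilon>: "\<epsilon> > 0" "\<epsilon> < r" "\<epsilon> \<le> 1/2" using r \<delta> K by (auto simp: \<epsilon>_def)
  have "2 * \<epsilon> \<le> \<delta> / (1 + K)" by (simp add: \<epsilon>_def)
  then have "2 * \<epsilon> * (1 + K) \<le> \<delta>" using K by (subst (asm) pos_le_divide_eq) auto
  moreover have "0 < \<epsilon> * (1 + K)" using \<epsilon> K by simp
  ultimately have \<epsilon>\<delta>: "\<epsilon> * (1 + K) \<le> \<delta>" by linarith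
  then have \<epsilon>_le: "\<epsilon> \<le> \<delta>" using mult_pos_pos[OF \<epsilon>(1) K(1)] by (simp add: algebra_simps)
  \<comment> \<open>Large enough that the estimate
    \<open>2 * C * \<rho> \<le> 4 * C\<^sup>2 / k\<close> falls below
    \<open>\<epsilon>\<^sup>2\<close>.\<close>
  define k where "k = 4 * C\<^sup>2 / \<epsilon>\<^sup>2 + 1"
  have k: "k > 0" by (simp add: k_def add_nonneg_pos)
  have k\<epsilon>: "4 * C\<^sup>2 < k * \<epsilon>\<^sup>2" using \<epsilon> by (simp add: k_def field_simps)
  define w where "w = A d"
  \<comment> \<open>Twice the penalized objective, to avoid fractions; the ball constraints on
    \<open>u\<close> and \<open>v\<close> provide compactness.\<close>
  define \<phi> where "\<phi> u v = k * ((A u - v) \<bullet> (A u - v)) + (u - d) \<bullet> (u - d) + (v - w) \<bullet> (v - w) - 2 * (g \<bullet> (u - d))"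
    for u v
  have "continuous_on (cball d r \<times> (T \<inter> cball w 1)) (\<lambda>(u, v). \<phi> u v)"
    unfolding \<phi>_def case_prod_unfold
    by (intro continuous_intros linear_continuous_on_compose[OF continuous_on_fst[OF continuous_on_id]] A.linear)
  moreover have "compact (cball d r \<times> (T \<inter> cball w 1))"
    using T by (intro compact_Times closed_Int_compact) auto
  moreover have "(d, w) \<in> cball d r \<times> (T \<inter> cball w 1)" using r d by (simp add: w_def)
  ultimately obtain u v where u: "u \<in> cball d r" and v: "v \<in> T" "v \<in> cball w 1"
    and min: "\<And>u' v'. u' \<in> cball d r \<Longrightarrow> v' \<in> T \<Longrightarrow> v' \<in> cball w 1 \<Longrightarrow> \<phi> u v \<le> \<phi> u' v'"
    using continuous_attains_inf[of "cball d r \<times> (T \<inter> cball w 1)" "\<lambda>(u, v). \<phi> u v"] by fastforce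
  define \<rho> where "\<rho> = norm (A u - v)"
  \<comment> \<open>At \<open>(d, w)\<close> the objective is 0. Through \<open>bound\<close> the
    residual itself limits the gain from the linear term, which is what bounds
    \<open>k * \<rho>\<close>.\<close>
  have "\<phi> u v \<le> \<phi> d w" using min r d by (simp add: w_def)
  then have *: "k * \<rho>\<^sup>2 + (norm (u - d))\<^sup>2 + (norm (v - w))\<^sup>2 \<le> 2 * (C * \<rho>)"
    using bound[OF u v(1)] by (simp add: \<phi>_def w_def \<rho>_def dot_square_norm)
  have "k * \<rho>\<^sup>2 \<le> 2 * C * \<rho>" using * zero_le_power2[of "norm (u - d)"] zero_le_power2[of "norm (v - w)"] by linarith
  then have \<rho>: "k * \<rho> \<le> 2 * C"
    using C by (cases "\<rho> = 0") (auto simp: power2_eq_square \<rho>_def)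
  have small: "2 * (C * \<rho>) < \<epsilon>\<^sup>2"
  proof -
    have "k * (2 * (C * \<rho>)) \<le> 4 * C\<^sup>2" using mult_left_mono[OF \<rho>, of "2 * C"] C
      by (simp add: power2_eq_square algebra_simps)
    then have "k * (2 * (C * \<rho>)) < k * \<epsilon>\<^sup>2" using k\<epsilon> by linarith
    then show ?thesis using k by simp
  qed
  have "k * \<rho>\<^sup>2 \<ge> 0" using k by simp
  then have "(norm (u - d))\<^sup>2 < \<epsilon>\<^sup>2" "(norm (v - w))\<^sup>2 < \<epsilon>\<^sup>2"
    using * small zero_le_power2[of "norm (u - d)"] zero_le_power2[of "norm (v - w)"] by linarith+
  then have ud: "norm (u - d) < \<epsilon>" and vw: "norm (v - w) < \<epsilon>"
    using \<epsilon> by (auto intro: power_less_imp_less_base)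
  \<comment> \<open>Minus half the derivative of \<open>\<phi>\<close> in \<open>v\<close>.
    Including \<open>v - w\<close> makes the proximal inequality exact and moves the error into the
    stationarity condition.\<close>
  define \<mu> where "\<mu> = k *\<^sub>R (A u - v) - (v - w)"
  have stat: "k * ((A u - v) \<bullet> A h) + (u - d) \<bullet> h - g \<bullet> h = 0" for h
  proof -
    have "((\<lambda>u. \<phi> u v) has_derivative
        (\<lambda>h. k * ((A u - v) \<bullet> A h + A h \<bullet> (A u - v)) + ((u - d) \<bullet> h + h \<bullet> (u - d)) - 2 * (g \<bullet> h))) (at u)"
      unfolding \<phi>_def
      by (rule derivative_eq_intros A.has_derivative refl | simp add: A.zero)+
    then have "(\<lambda>h. k * ((A u - v) \<bullet> A h + A h \<bullet> (A u - v)) + ((u - d) \<bullet> h + h \<bullet> (u - d)) - 2 * (g \<bullet> h)) = (\<lambda>h. 0)"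
      by (rule differential_zero_maxmin[of u "ball d r", rotated 2])
         (use ud \<epsilon> min v in \<open>auto simp: dist_norm norm_minus_commute\<close>)
    from fun_cong[OF this, of h] show ?thesis by (simp add: inner_commute algebra_simps)
  qed
  have "\<bar>\<mu> \<bullet> A h - g \<bullet> h\<bar> \<le> \<delta> * norm h" for h
  proof -
    have "\<mu> \<bullet> A h - g \<bullet> h = - ((u - d) \<bullet> h) - (v - w) \<bullet> A h"
      using stat[of h] by (simp add: \<mu>_def inner_diff_left)
    also have "\<bar>\<dots>\<bar> \<le> norm (u - d) * norm h + norm (v - w) * norm (A h)"
      using Cauchy_Schwarz_ineq2[of "u - d" h] Cauchy_Schwarz_ineq2[of "v - w" "A h"] by linarith
    also have "\<dots> \<le> \<epsilon> * norm h + \<epsilon> * (norm h * K)"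
      using ud vw K(2)[of h] \<epsilon> by (intro add_mono mult_mono) auto
    also have "\<dots> = \<epsilon> * (1 + K) * norm h" by (simp add: algebra_simps)
    also have "\<dots> \<le> \<delta> * norm h" using \<epsilon>\<delta> by (intro mult_right_mono) auto
    finally show ?thesis .
  qed
  moreover have "norm \<mu> \<le> 2 * C + \<delta>"
    using norm_triangle_ineq4[of "k *\<^sub>R (A u - v)" "v - w"] k \<rho> vw \<epsilon>_le by (simp add: \<mu>_def \<rho>_def)
  moreover have "\<mu> \<bullet> (p - v) \<le> (k + 1) / 2 * (norm (p - v))\<^sup>2" if p: "p \<in> T" "dist p v < 1/2" for p
  proof -
    have "dist w p \<le> 1"
      using p(2) vw \<epsilon>(3) dist_triangle[of p w v] by (simp add: dist_norm norm_minus_commute)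
    then have "\<phi> u v \<le> \<phi> u p" using min u p(1) by simp
    \<comment> \<open>Exact expansion, as the objective is quadratic in its second argument;
      minimality of \<open>v\<close> then gives the proximal inequality.\<close>
    moreover have "\<phi> u p = \<phi> u v - 2 * (\<mu> \<bullet> (p - v)) + (k + 1) * ((p - v) \<bullet> (p - v))"
      by (simp add: \<phi>_def \<mu>_def inner_diff_left inner_diff_right inner_commute algebra_simps)
    ultimately show ?thesis by (simp add: dot_square_norm)
  qed
  moreover have "dist v (A d) < \<delta>" using vw \<epsilon>_le by (simp add: w_def dist_norm)
  ultimately show ?thesis using v(1) by blast
qed

text \<open>Penalized multipliers for tolerances \<open>1 / (n + 1)\<close> are bounded by
  \<open>2 * C + 1\<close>. A cluster point satisfies the stationarity equation exactly and is a
  directional normal by closedness under limits. The constants \<open>M n\<close> need no uniform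
  bound, because each multiplier becomes a directional normal before the limit is taken.\<close>

lemma directional_multiplier_of_error_bound:
  fixes A :: "'a::euclidean_space \<Rightarrow> 'b::euclidean_space"
  assumes A: "bounded_linear A" and cl: "closed \<Gamma>" and d: "A d \<in> tangent_cone \<Gamma> y"
    and r: "r > 0" and C: "C \<ge> 0"
    and bound: "\<And>u v. u \<in> cball d r \<Longrightarrow> v \<in> tangent_cone \<Gamma> y \<Longrightarrow> g \<bullet> (u - d) \<le> C * norm (A u - v)"
  shows "\<exists>\<mu> \<in> directional_normal_cone \<Gamma> y (A d). \<forall>h. \<mu> \<bullet> A h = g \<bullet> h"
proof -
  define e where "e n = inverse (real (Suc n))" for n
  have e: "e n > 0" "e n \<le> 1" for n by (auto simp: e_def field_simps)
  have e0: "e \<longlonglongrightarrow> 0" unfolding e_def by (rule LIMSEQ_inverse_real_of_nat)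
  obtain v \<mu> M where v: "\<And>n. v n \<in> tangent_cone \<Gamma> y" "\<And>n. dist (v n) (A d) < e n"
    and \<mu>: "\<And>n. norm (\<mu> n) \<le> 2 * C + e n" "\<And>n h. \<bar>\<mu> n \<bullet> A h - g \<bullet> h\<bar> \<le> e n * norm h"
    and prox: "\<And>n p. p \<in> tangent_cone \<Gamma> y \<Longrightarrow> dist p (v n) < 1/2 \<Longrightarrow>
                 \<mu> n \<bullet> (p - v n) \<le> M n * (norm (p - v n))\<^sup>2"
    using penalized_multiplier[OF A closed_tangent_cone d r C bound e(1)] by metis
  have N: "\<mu> n \<in> directional_normal_cone \<Gamma> y (v n)" for n
    by (rule proximal_normal_tangent_cone_imp_directional_normal[OF cl v(1) _ prox, of "1/2"]) auto
  have "norm (\<mu> n) \<le> 2 * C + 1" for n using \<mu>(1)[of n] e(2)[of n] by linarith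
  then have "bounded (range \<mu>)" by (auto simp: bounded_iff)
  then obtain l s where s: "strict_mono s" and l: "(\<mu> \<circ> s) \<longlonglongrightarrow> l"
    using bounded_imp_convergent_subsequence by blast
  have es: "(e \<circ> s) \<longlonglongrightarrow> 0" using e0 s by (rule LIMSEQ_subseq_LIMSEQ)
  have "(\<lambda>n. dist (v (s n)) (A d)) \<longlonglongrightarrow> 0"
    by (rule tendsto_sandwich[OF _ _ tendsto_const es]) (auto intro!: always_eventually less_imp_le v)
  then have "(v \<circ> s) \<longlonglongrightarrow> A d" by (simp add: tendsto_dist_iff[of "v \<circ> s"])
  then have "l \<in> directional_normal_cone \<Gamma> y (A d)"
    using directional_normal_cone_limit[of "\<mu> \<circ> s" \<Gamma> y "v \<circ> s"] N l by simp
  moreover have "l \<bullet> A h = g \<bullet> h" for h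
  proof -
    have "(\<lambda>n. \<bar>\<mu> (s n) \<bullet> A h - g \<bullet> h\<bar>) \<longlonglongrightarrow> \<bar>l \<bullet> A h - g \<bullet> h\<bar>"
      using l by (intro tendsto_intros) (simp add: o_def)
    moreover have "(\<lambda>n. (e \<circ> s) n * norm h) \<longlonglongrightarrow> 0 * norm h" by (intro tendsto_intros es)
    ultimately have "\<bar>l \<bullet> A h - g \<bullet> h\<bar> \<le> 0 * norm h"
      by (rule LIMSEQ_le) (use \<mu>(2) in auto)
    then show ?thesis by simp
  qed
  ultimately show ?thesis by blast
qed

theorem lemma3p8:
  fixes f :: "real ^ 'n \<Rightarrow> real"
    and F :: "real ^ 'n \<Rightarrow> real ^ 'l"
    and \<Gamma> :: "(real ^ 'l) set"
    and x d :: "real ^ 'n"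
  assumes "continuously_differentiable_on f UNIV"
    and "directionally_differentiable F"
    and "locally_lipschitz F"
    and "\<Gamma> \<noteq> {}"
    and "closed \<Gamma>"
    and "local_minimizer f F \<Gamma> x"
    and "continuously_differentiable_around F x"
    and "GGCQ F \<Gamma> x"
    and "d \<in> critical_cone f F \<Gamma> x \<inter> sphere 0 1"
    and "locally_around polyhedral \<Gamma> (F x) \<or>
         (locally_around convex \<Gamma> (F x) \<and>
          metrically_subregular_in_direction (linearized_feasibility_map F \<Gamma> x) d 0 0)"
  shows "M_stationary_in_direction f F \<Gamma> x d"
proof -
  define T where "T = tangent_cone \<Gamma> (F x)"
  obtain A where A: "(F has_derivative A) (at x)"
    using assms(7) unfolding continuously_differentiable_around_def continuously_differentiable_on_def
    by blast
  then have bl: "bounded_linear A" by (rule has_derivative_bounded_linear)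
  have dirF: "dir_deriv F x u = A u" for u using A by (rule dir_deriv_eq_derivative)
  obtain D where D: "(f has_derivative D) (at x)"
    using assms(1) unfolding continuously_differentiable_on_def by blast
  then obtain g where g: "GDERIV f x :> g" using has_derivative_imp_GDERIV by blast
  define L where "L = {u. A u \<in> T}"
  have L: "linearization_cone F \<Gamma> x = L" by (simp add: linearization_cone_def dirF L_def T_def)
  have polar: "- g \<in> polar_cone L"
    using local_minimizer_imp_regular_normal[OF assms(6) g] assms(8) by (simp add: GGCQ_def L)
  have crit: "d \<in> critical_cone f F \<Gamma> x" and nd: "norm d = 1" using assms(9) by auto
  have "frechet_derivative f (at x) = (\<lambda>h. h \<bullet> g)"
    using g unfolding gderiv_def by (metis frechet_derivative_at)
  then have "d \<bullet> g \<le> 0" and dL: "d \<in> L" using crit by (auto simp: critical_cone_def L)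
  moreover have "- (g \<bullet> d) \<le> 0" using polar dL by (auto simp: polar_cone_def)
  \<comment> \<open>Criticality gives one sign and polarity the other, so \<open>d\<close> is a
    maximizer of \<open>- g\<close> over \<open>L\<close>, with value 0.\<close>
  ultimately have gd: "g \<bullet> d = 0" by (simp add: inner_commute)
  have "\<exists>r>0. \<exists>\<kappa>\<ge>0. \<forall>u\<in>cball d r. \<forall>v\<in>T. infdist u L \<le> \<kappa> * norm (A u - v)"
    using assms(10)
  proof
    assume "locally_around polyhedral \<Gamma> (F x)"
    from polyhedral_linear_error_bound[OF this bounded_linear.linear[OF bl]]
    \<comment> \<open>The polyhedral bound is global, so any radius serves.\<close>
    show ?thesis unfolding L_def T_def by (intro exI[of _ 1]) auto
  next
    assume "locally_around convex \<Gamma> (F x) \<and>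
      metrically_subregular_in_direction (linearized_feasibility_map F \<Gamma> x) d 0 0"
    then show ?thesis
      using subregular_linear_error_bound[OF _ A nd] unfolding L_def T_def by blast
  qed
  then obtain r \<kappa> where r: "r > 0" and \<kappa>: "\<kappa> \<ge> 0"
    and err: "\<And>u v. u \<in> cball d r \<Longrightarrow> v \<in> T \<Longrightarrow> infdist u L \<le> \<kappa> * norm (A u - v)"
    by blast
  have "closed L" unfolding L_def T_def by (rule closed_linear_preimage_tangent_cone[OF bl])
  have bound: "- g \<bullet> (u - d) \<le> (norm g * \<kappa>) * norm (A u - v)"
    if u: "u \<in> cball d r" and v: "v \<in> T" for u v
  proof -
    obtain p where p: "p \<in> L" "infdist u L = dist u p"
      using infdist_attains_inf[OF \<open>closed L\<close>] dL by blast
    \<comment> \<open>Splitting at the nearest point \<open>p\<close> of \<open>L\<close> leaves a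
      nonpositive term by polarity and one controlled by the distance to \<open>L\<close>.\<close>
    have "- g \<bullet> (u - d) = - g \<bullet> (u - p) + - g \<bullet> p" using gd by (simp add: inner_diff_right)
    also have "\<dots> \<le> norm g * norm (u - p)"
      using norm_cauchy_schwarz[of "- g" "u - p"] polar p(1) by (auto simp: polar_cone_def)
    also have "\<dots> \<le> norm g * (\<kappa> * norm (A u - v))"
      using err[OF u v] p(2) by (intro mult_left_mono) (auto simp: dist_norm)
    finally show ?thesis by (simp add: mult.assoc)
  qed
  have Ad: "A d \<in> tangent_cone \<Gamma> (F x)" using dL by (simp add: L_def T_def)
  obtain \<mu> where \<mu>: "\<mu> \<in> directional_normal_cone \<Gamma> (F x) (A d)" "\<And>h. \<mu> \<bullet> A h = - g \<bullet> h"
    using directional_multiplier_of_error_bound[OF bl assms(5) Ad r _ bound[unfolded T_def]] \<kappa>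
    by auto
  have "((\<lambda>y. \<mu> \<bullet> F y) has_derivative (\<lambda>h. \<mu> \<bullet> A h)) (at x)"
    by (intro has_derivative_inner_right A)
  then have "GDERIV (\<lambda>y. \<mu> \<bullet> F y) x :> - g"
    unfolding gderiv_def \<mu>(2) by (simp add: inner_commute)
  then have "- gradient f x \<in> directional_subdifferential (\<lambda>y. \<mu> \<bullet> F y) x d"
    unfolding gradient_eq[OF g]
    by (intro gradient_in_directional_subdifferential continuously_differentiable_around_inner assms(7))
  moreover have "x \<in> feasible_set F \<Gamma>" using assms(6) by (simp add: local_minimizer_def)
  ultimately show ?thesis
    unfolding M_stationary_in_direction_def dirF using crit \<mu>(1) by blast
qed

end
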